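(* Let $(M,g)$ be an oriented 5-dimensional Riemannian spin manifold, $\eta$ a unit-length section of its spinor bundle and $\alpha$ the 1-form of the $\mathrm{SU}(2)$ structure $(\alpha,\omega_1,\omega_2,\omega_3)$ determined by $\eta$. Then $$d\alpha=\alpha\wedge\tau_1^4+\sum_{k=1}^3\tau_0^k\omega_k+\tau_2^4,$$ where $\tau_0^1=-4\mu$, $\tau_0^2=4\lambda_3$, $\tau_0^3=-4\lambda_2$, $\tau_1^4=2J_1V_\xi^{*}$ with $V_\xi^*=g(V_\xi,\cdot)$, and $\tau_2^4=-4\,i(S_1)\omega_1$.
   Context: Spinors in dimension 5: Clifford convention $v\cdot v=-|v|^2$. $\Sigma(M)$ is the bundle associated to an irreducible real $\mathrm{Cl}_5$-module $W$ (real dimension 8), with invariant scalar product $\langle\cdot,\cdot\rangle$ for which vectors act skew-symmetrically, and spin connection $\nabla$. $\jmath_1$ is Clifford multiplication by the oriented unit volume form ($\jmath_1^2=-1$, commutes with vectors); $\jmath_2$ is a parallel isometry with $\jmath_2^2=-1$ anticommuting with Clifford multiplication by vectors; $\jmath_3=\jmath_1\jmath_2$. $\mathrm{SU}(2)$ structure of a unit spinor $\eta$: there is a rank-4 subbundle $\xi\subset TM$ such that $\xi\eta$ is the orthogonal complement of $\langle\eta,\jmath_1\eta,\jmath_2\eta,\jmath_3\eta\rangle$; define $J_k:\xi\to\xi$ by $J_k(X)\eta=\jmath_k(X\eta)$, and $\omega_k(X,Y)=g(J_kX_\xi,Y_\xi)$, $X_\xi$ the orthogonal projection to $\xi$. $R$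 is the unit vector field orthogonal to $\xi$ such that $TM=\xi\oplus\langle R\rangle$ as oriented bundles, $\xi$ oriented by $\omega_1^2|_\xi$; $\alpha=g(R,\cdot)$. Decomposition of $\nabla\eta$: there are unique $S\in\mathrm{End}(\xi)$, $V_\xi\in\xi$, $\Theta_l\in\xi^*$, $\phi_l\in C^\infty(M)$ with $\nabla_X\eta=S(X_\xi)\eta+\alpha(X)V_\xi\eta+\sum_{l=1}^3(\Theta_l(X_\xi)+\alpha(X)\phi_l)\jmath_l\eta$, where $X=X_\xi+\alpha(X)R$. Moreover $S=\mu\,\mathrm{I}+\sum_lS_l+\sum_l\lambda_lJ_l+S_0$ uniquely, with $\mu,\lambda_l$ functions, $S_k$ symmetric traceless, commuting with $J_k$ and anticommuting with $J_l$ for $l\ne k$, and $S_0$ skew-symmetric commuting with $J_1,J_2,J_3$. Conventions: forms on $\xi$ are extended by zero on $R$; for $\beta\in\xi^*$, $(J_k\beta)(X)=\beta(J_kX)$; $(i(A)\omega)(X,Y)=\omega(AX,Y)$ for $A\in\mathrm{End}(\xi)$. *)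

theory Defs
  imports "HOL-Analysis.Analysis"
begin

section \<open>Smooth manifolds of dimension five\<close>

primrec Ck_on :: "nat \<Rightarrow> 'a::real_normed_vector set \<Rightarrow> ('a \<Rightarrow> 'b::real_normed_vector) \<Rightarrow> bool" where
  "Ck_on 0 S f \<longleftrightarrow> continuous_on S f"
| "Ck_on (Suc k) S f \<longleftrightarrow>
     (\<forall>x\<in>S. f differentiable (at x)) \<and> (\<forall>v. Ck_on k S (\<lambda>x. frechet_derivative f (at x) v))"

text \<open>The set \<open>S\<close> is meant to be open.\<close>

definition smooth_on :: "'a::real_normed_vector set \<Rightarrow> ('a \<Rightarrow> 'b::real_normed_vector) \<Rightarrow> bool" where
  "smooth_on S f \<longleftrightarrow> (\<forall>k. Ck_on k S f)"

text \<open>A chart is a domain together with a coordinate map (only relevant on the domain).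
  The manifold itself is the whole type \<open>'m\<close>; the class constraints in
  \<open>spin_manifold\<close> below make it
  Hausdorff and second countable.\<close>

type_synonym 'm chart = "'m set \<times> ('m \<Rightarrow> real^5)"

definition cinv :: "'m chart \<Rightarrow> real^5 \<Rightarrow> 'm" where
  "cinv c = inv_into (fst c) (snd c)"

definition oriented_atlas :: "'m::topological_space chart set \<Rightarrow> bool" where
  "oriented_atlas A \<longleftrightarrow>
     (\<forall>c\<in>A. open (fst c) \<and> open (snd c ` fst c) \<and>
            homeomorphism (fst c) (snd c ` fst c) (snd c) (cinv c)) \<and>
     (\<Union>c\<in>A. fst c) = UNIV \<and>
     (\<forall>c\<in>A. \<forall>d\<in>A.
        smooth_on (snd c ` (fst c \<inter> fst d)) (snd d \<circ> cinv c) \<and>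
        (\<forall>y\<in>snd c ` (fst c \<inter> fst d). det (jacobian (snd d \<circ> cinv c) (at y)) > 0))"

text \<open>For each point one chart around it is singled out, and the tangent space at \<open>x\<close> is
  identified with \<open>real^5\<close> through the chart \<open>chart_at A x\<close>.  So every tangent vector has type
  \<open>real^5\<close>, but a vector field \<open>X :: 'm \<Rightarrow> real^5\<close> is not expressed in one chart;
  \<open>to_chart\<close> and \<open>from_chart\<close> convert to and from components in a given chart.\<close>

definition chart_at :: "'m chart set \<Rightarrow> 'm \<Rightarrow> 'm chart" where
  "chart_at A x = (SOME c. c \<in> A \<and> x \<in> fst c)"

definition deriv_along ::
    "'m chart set \<Rightarrow> ('m \<Rightarrow> 'b::real_normed_vector) \<Rightarrow> 'm \<Rightarrow> real^5 \<Rightarrow> 'b" where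
  "deriv_along A f x v =
     frechet_derivative (f \<circ> cinv (chart_at A x)) (at (snd (chart_at A x) x)) v"

definition to_chart :: "'m chart set \<Rightarrow> 'm chart \<Rightarrow> 'm \<Rightarrow> real^5 \<Rightarrow> real^5" where
  "to_chart A c x v = deriv_along A (snd c) x v"

definition from_chart :: "'m chart set \<Rightarrow> 'm chart \<Rightarrow> 'm \<Rightarrow> real^5 \<Rightarrow> real^5" where
  "from_chart A c x v = frechet_derivative (snd (chart_at A x) \<circ> cinv c) (at (snd c x)) v"

definition smooth_fun ::
    "'m chart set \<Rightarrow> 'm set \<Rightarrow> ('m \<Rightarrow> 'b::real_normed_vector) \<Rightarrow> bool" where
  "smooth_fun A U f \<longleftrightarrow> (\<forall>c\<in>A. smooth_on (snd c ` (fst c \<inter> U)) (f \<circ> cinv c))"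

definition smooth_vf :: "'m chart set \<Rightarrow> 'm set \<Rightarrow> ('m \<Rightarrow> real^5) \<Rightarrow> bool" where
  "smooth_vf A U X \<longleftrightarrow>
     (\<forall>c\<in>A. smooth_on (snd c ` (fst c \<inter> U)) (\<lambda>y. to_chart A c (cinv c y) (X (cinv c y))))"

text \<open>In coordinates \<open>(d\<alpha>)\<^sub>i\<^sub>j = \<partial>\<^sub>i \<alpha>\<^sub>j - \<partial>\<^sub>j \<alpha>\<^sub>i\<close>, i.e.
  \<open>d\<alpha>(X,Y) = X(\<alpha>(Y)) - Y(\<alpha>(X)) - \<alpha>([X,Y])\<close> without a factor 1/2; correspondingly
  \<open>(\<alpha> \<and> \<beta>)(X,Y) = \<alpha>(X)\<beta>(Y) - \<alpha>(Y)\<beta>(X)\<close>.\<close>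

definition ext_deriv ::
    "'m chart set \<Rightarrow> ('m \<Rightarrow> real^5 \<Rightarrow> real) \<Rightarrow> 'm \<Rightarrow> real^5 \<Rightarrow> real^5 \<Rightarrow> real" where
  "ext_deriv A \<alpha> x u v =
     (let c = chart_at A x;
          a = (\<lambda>y w. \<alpha> (cinv c y) (from_chart A c (cinv c y) w))
      in frechet_derivative (\<lambda>y. a y v) (at (snd c x)) u
         - frechet_derivative (\<lambda>y. a y u) (at (snd c x)) v)"

definition wedge1 :: "(real^5 \<Rightarrow> real) \<Rightarrow> (real^5 \<Rightarrow> real) \<Rightarrow> real^5 \<Rightarrow> real^5 \<Rightarrow> real" where
  "wedge1 \<alpha> \<beta> u v = \<alpha> u * \<beta> v - \<alpha> v * \<beta> u"

text \<open>The value of the 4-form \<open>\<omega> \<and> \<omega>\<close>.\<close>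

definition wedge_square ::
    "(real^5 \<Rightarrow> real^5 \<Rightarrow> real) \<Rightarrow> real^5 \<Rightarrow> real^5 \<Rightarrow> real^5 \<Rightarrow> real^5 \<Rightarrow> real" where
  "wedge_square \<omega> a b c d = 2 * (\<omega> a b * \<omega> c d - \<omega> a c * \<omega> b d + \<omega> a d * \<omega> b c)"

definition positive_basis :: "(5 \<Rightarrow> real^5) \<Rightarrow> bool" where
  "positive_basis b \<longleftrightarrow> det (\<chi> i j. b j $ i) > 0"


section \<open>Riemannian metrics and the Levi-Civita connection\<close>

definition metric_in_chart ::
    "'m chart set \<Rightarrow> ('m \<Rightarrow> real^5 \<Rightarrow> real^5 \<Rightarrow> real) \<Rightarrow> 'm chart \<Rightarrow> real^5 \<Rightarrow>
     real^5 \<Rightarrow> real^5 \<Rightarrow> real" where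
  "metric_in_chart A g c y u v =
     g (cinv c y) (from_chart A c (cinv c y) u) (from_chart A c (cinv c y) v)"

definition riemannian_metric ::
    "'m chart set \<Rightarrow> ('m \<Rightarrow> real^5 \<Rightarrow> real^5 \<Rightarrow> real) \<Rightarrow> bool" where
  "riemannian_metric A g \<longleftrightarrow>
     (\<forall>x. bilinear (g x) \<and> (\<forall>u v. g x u v = g x v u) \<and> (\<forall>u. u \<noteq> 0 \<longrightarrow> g x u u > 0)) \<and>
     (\<forall>c\<in>A. \<forall>u v. smooth_on (snd c ` fst c) (\<lambda>y. metric_in_chart A g c y u v))"

text \<open>\<open>levi_civita A g X x u\<close> is \<open>\<nabla>\<^sub>u X\<close> at the point \<open>x\<close>, for a vector field \<open>X\<close> defined
  near \<open>x\<close>: derivative of the components plus the Christoffel symbols of the first kind,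
  \<open>\<Gamma>(u,X;w) = (\<partial>\<^sub>u g(X,w) + \<partial>\<^sub>X g(u,w) - \<partial>\<^sub>w g(u,X)) / 2\<close>, both taken in \<open>chart_at A x\<close>.\<close>

definition levi_civita ::
    "'m chart set \<Rightarrow> ('m \<Rightarrow> real^5 \<Rightarrow> real^5 \<Rightarrow> real) \<Rightarrow> ('m \<Rightarrow> real^5) \<Rightarrow> 'm \<Rightarrow> real^5 \<Rightarrow> real^5" where
  "levi_civita A g X x u =
     (let c = chart_at A x; y0 = snd c x;
          Xc = (\<lambda>y. to_chart A c (cinv c y) (X (cinv c y)));
          dg = (\<lambda>r s t. frechet_derivative (\<lambda>y. metric_in_chart A g c y s t) (at y0) r)
      in THE z. \<forall>w. g x z w =
           g x (frechet_derivative Xc (at y0) u) w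
           + (dg u (X x) w + dg (X x) u w - dg w u (X x)) / 2)"


section \<open>Clifford modules, spin structures and spinors\<close>

text \<open>By the universal property of the Clifford algebra, a module over it is given by a linear map
  from \<open>real^5\<close> into the endomorphisms satisfying the Clifford relation.\<close>

definition irreducible_clifford_module ::
    "(real^5 \<Rightarrow> 'w::euclidean_space \<Rightarrow> 'w) \<Rightarrow> bool" where
  "irreducible_clifford_module c \<longleftrightarrow>
     bilinear c \<and>
     (\<forall>v w. c v (c v w) = - ((norm v)\<^sup>2 *\<^sub>R w)) \<and>
     (\<forall>v w w'. c v w \<bullet> w' = - (w \<bullet> c v w')) \<and>
     (\<forall>N. subspace N \<and> (\<forall>v. c v ` N \<subseteq> N) \<longrightarrow> N = {0} \<or> N = UNIV)"

text \<open>The group Spin(5), as it acts on the (faithful) module: compositions of an even number of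
  Clifford multiplications by unit vectors.\<close>

definition spin_group :: "(real^5 \<Rightarrow> 'w::euclidean_space \<Rightarrow> 'w) \<Rightarrow> ('w \<Rightarrow> 'w) set" where
  "spin_group c =
     {foldr (\<lambda>v f. c v \<circ> f) vs id | vs. even (length vs) \<and> (\<forall>v\<in>set vs. norm v = 1)}"

text \<open>A spin manifold is presented by local trivialisations of its spin structure: an open cover
  \<open>patch\<close> indexed by \<open>'i\<close>, an oriented orthonormal frame on each member of the cover, and a
  Spin(5)-valued cocycle \<open>cocycle\<close> which lifts the transition matrices of the frames.\<close>

record ('m, 'i, 'w) spin_data =
  atl :: "'m chart set"
  met :: "'m \<Rightarrow> real^5 \<Rightarrow> real^5 \<Rightarrow> real"
  cl :: "real^5 \<Rightarrow> 'w \<Rightarrow> 'w"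
  patch :: "'i \<Rightarrow> 'm set"
  frame :: "'i \<Rightarrow> 'm \<Rightarrow> 5 \<Rightarrow> real^5"
  cocycle :: "'i \<Rightarrow> 'i \<Rightarrow> 'm \<Rightarrow> 'w \<Rightarrow> 'w"

text \<open>Clifford multiplication by a tangent vector, in the trivialisation \<open>a\<close>.\<close>

definition cmult :: "('m, 'i, 'w) spin_data \<Rightarrow> 'i \<Rightarrow> 'm \<Rightarrow> real^5 \<Rightarrow> 'w \<Rightarrow> 'w" where
  "cmult M a x v = cl M (\<chi> i. met M x v (frame M a x i))"

definition spin_manifold ::
    "('m::{t2_space,second_countable_topology}, 'i, 'w::euclidean_space) spin_data \<Rightarrow> bool" where
  "spin_manifold M \<longleftrightarrow>
     oriented_atlas (atl M) \<and> riemannian_metric (atl M) (met M) \<and>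
     irreducible_clifford_module (cl M) \<and>
     (\<forall>a. open (patch M a)) \<and> (\<Union>a. patch M a) = UNIV \<and>
     (\<forall>a i. smooth_vf (atl M) (patch M a) (\<lambda>x. frame M a x i)) \<and>
     (\<forall>a. \<forall>x\<in>patch M a.
        (\<forall>i j. met M x (frame M a x i) (frame M a x j) = (if i = j then 1 else 0)) \<and>
        positive_basis (frame M a x)) \<and>
     (\<forall>a b w. smooth_fun (atl M) (patch M a \<inter> patch M b) (\<lambda>x. cocycle M a b x w)) \<and>
     (\<forall>a b. \<forall>x\<in>patch M a \<inter> patch M b.
        cocycle M a b x \<in> spin_group (cl M) \<and>
        (\<forall>v. cmult M a x v \<circ> cocycle M a b x = cocycle M a b x \<circ> cmult M b x v)) \<and>
     (\<forall>a. \<forall>x\<in>patch M a. cocycle M a a x = id) \<and>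
     (\<forall>a b d. \<forall>x\<in>patch M a \<inter> patch M b \<inter> patch M d.
        cocycle M a b x \<circ> cocycle M b d x = cocycle M a d x)"

text \<open>A section of the associated bundle is a family of local functions, related by the cocycle.\<close>

definition smooth_spinor ::
    "('m::{t2_space,second_countable_topology}, 'i, 'w::euclidean_space) spin_data \<Rightarrow>
     ('i \<Rightarrow> 'm \<Rightarrow> 'w) \<Rightarrow> bool" where
  "smooth_spinor M \<eta> \<longleftrightarrow>
     (\<forall>a. smooth_fun (atl M) (patch M a) (\<eta> a)) \<and>
     (\<forall>a b. \<forall>x\<in>patch M a \<inter> patch M b. \<eta> a x = cocycle M a b x (\<eta> b x))"

definition unit_spinor :: "('m, 'i, 'w::euclidean_space) spin_data \<Rightarrow> ('i \<Rightarrow> 'm \<Rightarrow> 'w) \<Rightarrow> bool" where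
  "unit_spinor M \<eta> \<longleftrightarrow> (\<forall>a. \<forall>x\<in>patch M a. norm (\<eta> a x) = 1)"

text \<open>The spin connection in the trivialisation \<open>a\<close>:
  \<open>\<nabla>\<^sub>v \<psi> = d\<psi>(v) + 1/2 \<Sum>\<^sub>i\<^sub><\<^sub>j g(\<nabla>\<^sub>v e\<^sub>i, e\<^sub>j) e\<^sub>i e\<^sub>j \<psi>\<close>.
  The sum over all \<open>i, j\<close> counts each pair twice and its diagonal terms vanish.\<close>

definition spin_conn ::
    "('m, 'i, 'w::euclidean_space) spin_data \<Rightarrow> 'i \<Rightarrow> ('m \<Rightarrow> 'w) \<Rightarrow> 'm \<Rightarrow> real^5 \<Rightarrow> 'w" where
  "spin_conn M a \<psi> x v =
     deriv_along (atl M) \<psi> x v +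
     (1/4) *\<^sub>R (\<Sum>i\<in>UNIV. \<Sum>j\<in>UNIV.
        met M x (levi_civita (atl M) (met M) (\<lambda>y. frame M a y i) x v) (frame M a x j) *\<^sub>R
        cmult M a x (frame M a x i) (cmult M a x (frame M a x j) (\<psi> x)))"

text \<open>Clifford multiplication by the volume form \<open>e\<^sub>1 e\<^sub>2 e\<^sub>3 e\<^sub>4 e\<^sub>5\<close>.  In the index type \<open>5\<close> the
  numerals are \<open>1, 2, 3, 4\<close> and \<open>5 = 0\<close>.\<close>

definition vol_mult ::
    "('m, 'i, 'w) spin_data \<Rightarrow> 'i \<Rightarrow> 'm \<Rightarrow> 'w \<Rightarrow> 'w" where
  "vol_mult M a x w =
     (let e = (\<lambda>i. cmult M a x (frame M a x i)) in e 1 (e 2 (e 3 (e 4 (e 5 w)))))"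

text \<open>The conditions on \<open>\<jmath>\<^sub>2\<close>, a bundle endomorphism given by its local representatives.\<close>

definition parallel_anticommuting_structure ::
    "('m::{t2_space,second_countable_topology}, 'i, 'w::euclidean_space) spin_data \<Rightarrow>
     ('i \<Rightarrow> 'm \<Rightarrow> 'w \<Rightarrow> 'w) \<Rightarrow> bool" where
  "parallel_anticommuting_structure M j2 \<longleftrightarrow>
     (\<forall>a w. smooth_fun (atl M) (patch M a) (\<lambda>x. j2 a x w)) \<and>
     (\<forall>a. \<forall>x\<in>patch M a.
        linear (j2 a x) \<and> (\<forall>w. norm (j2 a x w) = norm w) \<and> (\<forall>w. j2 a x (j2 a x w) = - w) \<and>
        (\<forall>v w. j2 a x (cmult M a x v w) = - cmult M a x v (j2 a x w))) \<and>
     (\<forall>a b. \<forall>x\<in>patch M a \<inter> patch M b. j2 a x \<circ> cocycle M a b x = cocycle M a b x \<circ> j2 b x) \<and>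
     (\<forall>a U \<psi>. open U \<and> U \<subseteq> patch M a \<and> smooth_fun (atl M) U \<psi> \<longrightarrow>
        (\<forall>x\<in>U. \<forall>v. spin_conn M a (\<lambda>y. j2 a y (\<psi> y)) x v = j2 a x (spin_conn M a \<psi> x v)))"

text \<open>\<open>\<jmath>\<^sub>k\<close> for \<open>k\<close> in \<open>{1..3}\<close>.\<close>

definition jspin ::
    "('m, 'i, 'w) spin_data \<Rightarrow> ('i \<Rightarrow> 'm \<Rightarrow> 'w \<Rightarrow> 'w) \<Rightarrow> nat \<Rightarrow> 'i \<Rightarrow> 'm \<Rightarrow> 'w \<Rightarrow> 'w" where
  "jspin M j2 k a x =
     (if k = 1 then vol_mult M a x else if k = 2 then j2 a x else vol_mult M a x \<circ> j2 a x)"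


section \<open>The SU(2) structure of a unit spinor\<close>

definition smooth_rank4_subbundle ::
    "'m::topological_space chart set \<Rightarrow> ('m \<Rightarrow> (real^5) set) \<Rightarrow> bool" where
  "smooth_rank4_subbundle A \<xi> \<longleftrightarrow>
     (\<forall>x. subspace (\<xi> x) \<and> dim (\<xi> x) = 4) \<and>
     (\<forall>x. \<exists>U b. open U \<and> x \<in> U \<and> (\<forall>i::4. smooth_vf A U (b i)) \<and>
        (\<forall>y\<in>U. \<xi> y = span (range (\<lambda>i. b i y))))"

text \<open>Orthogonal projection onto a subspace with respect to an inner product \<open>h\<close>.\<close>

definition oproj :: "(real^5 \<Rightarrow> real^5 \<Rightarrow> real) \<Rightarrow> (real^5) set \<Rightarrow> real^5 \<Rightarrow> real^5" where
  "oproj h E v = (THE u. u \<in> E \<and> (\<forall>w\<in>E. h (v - u) w = 0))"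

definition omega ::
    "('m, 'i, 'w) spin_data \<Rightarrow> ('m \<Rightarrow> (real^5) set) \<Rightarrow> (nat \<Rightarrow> 'm \<Rightarrow> real^5 \<Rightarrow> real^5) \<Rightarrow> nat \<Rightarrow>
     'm \<Rightarrow> real^5 \<Rightarrow> real^5 \<Rightarrow> real" where
  "omega M \<xi> J k x u v = met M x (J k x (oproj (met M x) (\<xi> x) u)) (oproj (met M x) (\<xi> x) v)"

text \<open>An endomorphism of the bundle \<open>\<xi>\<close> is a map of tangent vectors that is only relevant on \<open>\<xi>\<close>;
  similarly for a section of the dual of \<open>\<xi>\<close>.\<close>

definition section_End ::
    "'m::topological_space chart set \<Rightarrow> ('m \<Rightarrow> (real^5) set) \<Rightarrow> ('m \<Rightarrow> real^5 \<Rightarrow> real^5) \<Rightarrow> bool" where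
  "section_End A \<xi> T \<longleftrightarrow>
     (\<forall>x. \<forall>u\<in>\<xi> x. T x u \<in> \<xi> x) \<and>
     (\<forall>x. \<forall>u\<in>\<xi> x. \<forall>v\<in>\<xi> x. \<forall>r s. T x (r *\<^sub>R u + s *\<^sub>R v) = r *\<^sub>R T x u + s *\<^sub>R T x v) \<and>
     (\<forall>U X. open U \<and> smooth_vf A U X \<and> (\<forall>y\<in>U. X y \<in> \<xi> y) \<longrightarrow> smooth_vf A U (\<lambda>y. T y (X y)))"

definition section_dual ::
    "'m::topological_space chart set \<Rightarrow> ('m \<Rightarrow> (real^5) set) \<Rightarrow> ('m \<Rightarrow> real^5 \<Rightarrow> real) \<Rightarrow> bool" where
  "section_dual A \<xi> \<theta> \<longleftrightarrow>
     (\<forall>x. \<forall>u\<in>\<xi> x. \<forall>v\<in>\<xi> x. \<forall>r s. \<theta> x (r *\<^sub>R u + s *\<^sub>R v) = r * \<theta> x u + s * \<theta> x v) \<and>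
     (\<forall>U X. open U \<and> smooth_vf A U X \<and> (\<forall>y\<in>U. X y \<in> \<xi> y) \<longrightarrow> smooth_fun A U (\<lambda>y. \<theta> y (X y)))"

text \<open>\<open>\<xi>\<close>, \<open>J\<^sub>1, J\<^sub>2, J\<^sub>3\<close> (on \<open>\<xi>\<close>) and \<open>R\<close> are uniquely determined by \<open>\<eta>\<close> through these conditions.
  The last one says that \<open>TM\<close> is the oriented direct sum of \<open>\<xi>\<close>, oriented by
  \<open>\<omega>\<^sub>1 \<and> \<omega>\<^sub>1\<close>, and the line of \<open>R\<close>, in this order.\<close>

definition su2_structure_of ::
    "('m::{t2_space,second_countable_topology}, 'i, 'w::euclidean_space) spin_data \<Rightarrow>
     ('i \<Rightarrow> 'm \<Rightarrow> 'w \<Rightarrow> 'w) \<Rightarrow> ('i \<Rightarrow> 'm \<Rightarrow> 'w) \<Rightarrow>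
     ('m \<Rightarrow> (real^5) set) \<Rightarrow> (nat \<Rightarrow> 'm \<Rightarrow> real^5 \<Rightarrow> real^5) \<Rightarrow> ('m \<Rightarrow> real^5) \<Rightarrow> bool" where
  "su2_structure_of M j2 \<eta> \<xi> J R \<longleftrightarrow>
     smooth_rank4_subbundle (atl M) \<xi> \<and>
     (\<forall>a. \<forall>x\<in>patch M a.
        (\<lambda>v. cmult M a x v (\<eta> a x)) ` \<xi> x =
        (span ({\<eta> a x} \<union> (\<lambda>k. jspin M j2 k a x (\<eta> a x)) ` {1..3}))\<^sup>\<bottom>) \<and>
     (\<forall>k\<in>{1..3}. section_End (atl M) \<xi> (J k) \<and>
        (\<forall>a. \<forall>x\<in>patch M a. \<forall>v\<in>\<xi> x.
           cmult M a x (J k x v) (\<eta> a x) = jspin M j2 k a x (cmult M a x v (\<eta> a x)))) \<and>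
     smooth_vf (atl M) UNIV R \<and>
     (\<forall>x. met M x (R x) (R x) = 1 \<and> (\<forall>v\<in>\<xi> x. met M x (R x) v = 0)) \<and>
     (\<forall>x b. (\<forall>i. i \<noteq> 5 \<longrightarrow> b i \<in> \<xi> x) \<and> b 5 = R x \<and>
        wedge_square (omega M \<xi> J 1 x) (b 1) (b 2) (b 3) (b 4) > 0 \<longrightarrow> positive_basis b)"

definition spinor_decomposition ::
    "('m::{t2_space,second_countable_topology}, 'i, 'w::euclidean_space) spin_data \<Rightarrow>
     ('i \<Rightarrow> 'm \<Rightarrow> 'w \<Rightarrow> 'w) \<Rightarrow> ('i \<Rightarrow> 'm \<Rightarrow> 'w) \<Rightarrow> ('m \<Rightarrow> (real^5) set) \<Rightarrow> ('m \<Rightarrow> real^5) \<Rightarrow>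
     ('m \<Rightarrow> real^5 \<Rightarrow> real^5) \<Rightarrow> ('m \<Rightarrow> real^5) \<Rightarrow> (nat \<Rightarrow> 'm \<Rightarrow> real^5 \<Rightarrow> real) \<Rightarrow> (nat \<Rightarrow> 'm \<Rightarrow> real) \<Rightarrow>
     bool" where
  "spinor_decomposition M j2 \<eta> \<xi> R S V \<Theta> \<phi> \<longleftrightarrow>
     section_End (atl M) \<xi> S \<and>
     smooth_vf (atl M) UNIV V \<and> (\<forall>x. V x \<in> \<xi> x) \<and>
     (\<forall>l\<in>{1..3}. section_dual (atl M) \<xi> (\<Theta> l) \<and> smooth_fun (atl M) UNIV (\<phi> l)) \<and>
     (\<forall>a. \<forall>x\<in>patch M a. \<forall>X.
        let X\<^sub>\<xi> = oproj (met M x) (\<xi> x) X; \<alpha>X = met M x (R x) X in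
        spin_conn M a (\<eta> a) x X =
          cmult M a x (S x X\<^sub>\<xi>) (\<eta> a x) + \<alpha>X *\<^sub>R cmult M a x (V x) (\<eta> a x) +
          (\<Sum>l\<in>{1..3}. (\<Theta> l x X\<^sub>\<xi> + \<alpha>X * \<phi> l x) *\<^sub>R jspin M j2 l a x (\<eta> a x)))"

text \<open>The decomposition of \<open>S\<close>.  The trace of an endomorphism of \<open>\<xi>\<close> is computed after extending
  it by zero on the orthogonal complement.\<close>

definition endomorphism_decomposition ::
    "('m::{t2_space,second_countable_topology}, 'i, 'w::euclidean_space) spin_data \<Rightarrow>
     ('m \<Rightarrow> (real^5) set) \<Rightarrow> (nat \<Rightarrow> 'm \<Rightarrow> real^5 \<Rightarrow> real^5) \<Rightarrow> ('m \<Rightarrow> real^5 \<Rightarrow> real^5) \<Rightarrow>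
     ('m \<Rightarrow> real) \<Rightarrow> (nat \<Rightarrow> 'm \<Rightarrow> real^5 \<Rightarrow> real^5) \<Rightarrow> (nat \<Rightarrow> 'm \<Rightarrow> real) \<Rightarrow>
     ('m \<Rightarrow> real^5 \<Rightarrow> real^5) \<Rightarrow> bool" where
  "endomorphism_decomposition M \<xi> J S \<mu> Sk lam S0 \<longleftrightarrow>
     smooth_fun (atl M) UNIV \<mu> \<and> (\<forall>l\<in>{1..3}. smooth_fun (atl M) UNIV (lam l)) \<and>
     (\<forall>k\<in>{1..3}. section_End (atl M) \<xi> (Sk k) \<and>
        (\<forall>x. trace (matrix (\<lambda>v. Sk k x (oproj (met M x) (\<xi> x) v))) = 0 \<and>
             (\<forall>u\<in>\<xi> x. \<forall>v\<in>\<xi> x. met M x (Sk k x u) v = met M x u (Sk k x v)) \<and>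
             (\<forall>u\<in>\<xi> x. Sk k x (J k x u) = J k x (Sk k x u)) \<and>
             (\<forall>l\<in>{1..3} - {k}. \<forall>u\<in>\<xi> x. Sk k x (J l x u) = - J l x (Sk k x u)))) \<and>
     section_End (atl M) \<xi> S0 \<and>
     (\<forall>x. (\<forall>u\<in>\<xi> x. \<forall>v\<in>\<xi> x. met M x (S0 x u) v = - met M x u (S0 x v)) \<and>
          (\<forall>l\<in>{1..3}. \<forall>u\<in>\<xi> x. S0 x (J l x u) = J l x (S0 x u))) \<and>
     (\<forall>x. \<forall>u\<in>\<xi> x.
        S x u = \<mu> x *\<^sub>R u + (\<Sum>l\<in>{1..3}. Sk l x u) + (\<Sum>l\<in>{1..3}. lam l x *\<^sub>R J l x u) + S0 x u)"

end

theory Submission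
  imports Defs
begin

text \<open>The spinors \<open>\<eta>\<close>, \<open>\<jmath>\<^sub>k\<eta>\<close> span the orthogonal complement of \<open>\<xi>\<eta>\<close>, and among them
  only \<open>\<jmath>\<^sub>1\<eta>\<close> can have a component along \<open>R\<eta>\<close>, so \<open>R\<eta> = \<plusminus> \<jmath>\<^sub>1\<eta>\<close>.  Evaluating the volume form
  on an oriented basis \<open>(X, J\<^sub>1X, Y, J\<^sub>1Y, R)\<close> gives \<open>R\<eta> = - \<jmath>\<^sub>1\<eta>\<close>, hence
  \<open>\<alpha>(X) = - \<langle>\<jmath>\<^sub>1\<eta>, X\<eta>\<rangle>\<close>.  The Levi-Civita connection being torsion-free,
  \<open>d\<alpha>(X,Y) = 2\<langle>\<jmath>\<^sub>1\<nabla>\<^sub>Y\<eta>, X\<eta>\<rangle> - 2\<langle>\<jmath>\<^sub>1\<nabla>\<^sub>X\<eta>, Y\<eta>\<rangle>\<close>.  The terms of \<open>\<nabla>\<eta>\<close> along \<open>\<jmath>\<^sub>l\<eta>\<close> are killed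
  by these products, and the (anti)commutation relations with \<open>J\<^sub>1\<close> single out the components of
  \<open>S\<close> and \<open>V\<close> that survive.\<close>

section \<open>Clifford multiplication\<close>

lemma exhaust_5: "x = 1 \<or> x = 2 \<or> x = 3 \<or> x = 4 \<or> x = 5" for x :: 5
proof (induct x)
  case (of_int z)
  \<comment> \<open>Indices are taken modulo 5, so the representative 0 is the numeral 5.\<close>
  then have "z = 0 \<or> z = 1 \<or> z = 2 \<or> z = 3 \<or> z = 4" by fastforce
  then show ?case by auto
qed

locale clifford_module =
  fixes cl :: "real^5 \<Rightarrow> 'w::euclidean_space \<Rightarrow> 'w"
  assumes irreducible: "irreducible_clifford_module cl"
begin

lemma bilinear_cl: "bilinear cl"
  and cl_cl_same: "cl v (cl v w) = - ((norm v)\<^sup>2 *\<^sub>R w)"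
  and cl_skew: "cl v w \<bullet> w' = - (w \<bullet> cl v w')"
  using irreducible unfolding irreducible_clifford_module_def by blast+

lemma linear_cl: "linear (cl v)" and linear_cl_left: "linear (\<lambda>v. cl v w)"
  using bilinear_cl by (simp_all add: bilinear_def)

lemmas cl_simps =
  linear_add[OF linear_cl] linear_diff[OF linear_cl] linear_scale[OF linear_cl]
  linear_neg[OF linear_cl] linear_0[OF linear_cl] linear_sum[OF linear_cl]
  linear_add[OF linear_cl_left] linear_diff[OF linear_cl_left] linear_scale[OF linear_cl_left]
  linear_neg[OF linear_cl_left] linear_0[OF linear_cl_left]

text \<open>Polarisation of the Clifford relation.\<close>

lemma cl_anticommute: "cl u (cl v w) = - cl v (cl u w) - (2 * (u \<bullet> v)) *\<^sub>R w"
proof -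
  have "cl (u + v) (cl (u + v) w) = - ((norm (u + v))\<^sup>2 *\<^sub>R w)" by (rule cl_cl_same)
  then have "cl u (cl v w) + cl v (cl u w) = ((norm u)\<^sup>2 + (norm v)\<^sup>2 - (norm (u + v))\<^sup>2) *\<^sub>R w"
    by (simp add: cl_simps cl_cl_same algebra_simps)
  also have "(norm u)\<^sup>2 + (norm v)\<^sup>2 - (norm (u + v))\<^sup>2 = - 2 * (u \<bullet> v)"
    by (simp add: power2_norm_eq_inner inner_add inner_commute)
  finally have "cl u (cl v w) = (- 2 * (u \<bullet> v)) *\<^sub>R w - cl v (cl u w)"
    by (simp only: eq_diff_eq)
  then show ?thesis by simp
qed

text \<open>Skewness turns the pairing into \<open>w\<close> against either order of the product, so
  only the symmetric part of the product, a scalar, survives. For unit \<open>w\<close> the map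
  sending \<open>v\<close> to \<open>cl v w\<close> is thus an isometry; all later passages between
  metric and spinors rest on this.\<close>

lemma cl_inner_cl: "cl u w \<bullet> cl v w = (u \<bullet> v) * (w \<bullet> w)"
proof -
  have "cl u w \<bullet> cl v w = - (w \<bullet> cl u (cl v w))" by (rule cl_skew)
  moreover have "cl v w \<bullet> cl u w = - (w \<bullet> cl v (cl u w))" by (rule cl_skew)
  ultimately have "2 * (cl u w \<bullet> cl v w) = - (w \<bullet> (cl u (cl v w) + cl v (cl u w)))"
    by (simp add: inner_add_right inner_commute)
  also have "\<dots> = 2 * ((u \<bullet> v) * (w \<bullet> w))" by (subst cl_anticommute) simp
  finally show ?thesis by simp
qed

lemma cl_inner_same: "cl v w \<bullet> w = 0"
  using cl_skew[of v w w] by (simp add: inner_commute)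

text \<open>Bases are stored as rows of a matrix so that \<open>det\<close> records their
  orientation; for orthonormal rows this is the Clifford product of the basis.\<close>

definition row_prod :: "real^5^5 \<Rightarrow> 'w \<Rightarrow> 'w" where
  "row_prod A w = cl (A $ 1) (cl (A $ 2) (cl (A $ 3) (cl (A $ 4) (cl (A $ 5) w))))"

definition vol :: "'w \<Rightarrow> 'w" where "vol = row_prod (mat 1)"

lemma mat_1_nth: "(mat 1 :: real^5^5) $ i = axis i 1"
  by (vector mat_def axis_def)

lemma vol_eq: "vol w = cl (axis 1 1) (cl (axis 2 1) (cl (axis 3 1) (cl (axis 4 1) (cl (axis 5 1) w))))"
  by (simp add: vol_def row_prod_def mat_1_nth)

lemma cl_axis_anticommute: "i \<noteq> j \<Longrightarrow> cl (axis i 1) (cl (axis j 1) w) = - cl (axis j 1) (cl (axis i 1) w)"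
  by (subst cl_anticommute) (simp add: inner_axis_axis)

text \<open>Instances directed so that rewriting sorts a product of basis vectors by increasing
  index and terminates.\<close>

lemmas cl_axis_sort = cl_axis_anticommute[of 2 1] cl_axis_anticommute[of 3 1] cl_axis_anticommute[of 4 1]
    cl_axis_anticommute[of 5 1] cl_axis_anticommute[of 3 2] cl_axis_anticommute[of 4 2]
    cl_axis_anticommute[of 5 2] cl_axis_anticommute[of 4 3] cl_axis_anticommute[of 5 3]
    cl_axis_anticommute[of 5 4]

lemma cl_axis_same: "cl (axis i 1) (cl (axis i 1) w) = - w"
  by (simp add: cl_cl_same)

lemma linear_vol: "linear vol"
  unfolding vol_eq[abs_def] by (rule linearI) (simp_all add: cl_simps)

lemmas vol_simps = linear_add[OF linear_vol] linear_diff[OF linear_vol] linear_scale[OF linear_vol]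
  linear_neg[OF linear_vol] linear_0[OF linear_vol] linear_sum[OF linear_vol]

text \<open>A basis vector passes the four others with a sign each, an even number: the dimension is
  odd.\<close>

lemma vol_cl_axis: "vol (cl (axis i 1) w) = cl (axis i 1) (vol w)"
proof -
  consider "i = 1" | "i = 2" | "i = 3" | "i = 4" | "i = 5" using exhaust_5 by blast
  then show ?thesis
    by cases (simp_all add: vol_eq cl_axis_sort cl_simps cl_axis_same del: one_neq_zero)
qed

lemma cl_axis_sum: "cl v w = (\<Sum>i\<in>UNIV. (v $ i) *\<^sub>R cl (axis i 1) w)"
proof -
  have "v = (\<Sum>i\<in>UNIV. (v $ i) *\<^sub>R axis i 1)"
    by (simp add: vec_eq_iff axis_def if_distrib cong: if_cong)
  then have "cl v w = cl (\<Sum>i\<in>UNIV. (v $ i) *\<^sub>R axis i 1) w" by simp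
  also have "\<dots> = (\<Sum>i\<in>UNIV. (v $ i) *\<^sub>R cl (axis i 1) w)"
    by (simp add: linear_sum[OF linear_cl_left] linear_scale[OF linear_cl_left])
  finally show ?thesis .
qed

lemma vol_cl: "vol (cl v w) = cl v (vol w)"
  by (subst (1 2) cl_axis_sum) (simp add: vol_simps vol_cl_axis)

text \<open>Reversing five factors takes ten transpositions, hence no sign, and the five squares
  contribute -1 each.\<close>

lemma vol_vol: "vol (vol w) = - w"
  by (simp add: vol_eq cl_axis_sort cl_simps cl_axis_same)

text \<open>Five skew factors give -1, and the reversal of their order gives no sign.\<close>

lemma vol_skew: "vol w \<bullet> w' = - (w \<bullet> vol w')"
  by (simp add: vol_eq cl_skew cl_axis_sort cl_simps)

lemma vol_inner_vol: "vol w \<bullet> vol w' = w \<bullet> w'"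
  by (simp add: vol_skew vol_vol)

end

section \<open>Reflections and the volume element of an arbitrary orthonormal basis\<close>

lemma orthogonal_matrix_iff_rows:
  "orthogonal_matrix (A :: real^'n^'n) \<longleftrightarrow> (\<forall>i j. A $ i \<bullet> A $ j = (if i = j then 1 else 0))"
  unfolding orthogonal_matrix_orthonormal_rows row_def orthogonal_def
  by (auto simp: norm_eq_1)

lemma matrix_diff_ldistrib: "A ** (B - C) = A ** B - A ** (C :: real^'n^'m)" for A :: "real^'m^'k"
  by (simp add: matrix_matrix_mult_def vec_eq_iff algebra_simps sum_subtractf)

definition reflect :: "real^'n \<Rightarrow> real^'n \<Rightarrow> real^'n" where
  "reflect n v = v - (2 * (n \<bullet> v)) *\<^sub>R n"

text \<open>Reflecting all rows is right multiplication by the matrix of the reflection. An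
  orthogonal matrix sending a basis vector to \<open>n\<close> conjugates the latter to a diagonal
  matrix with a single entry -1.\<close>

lemma det_reflect_rows:
  fixes A :: "real^'n^'n"
  assumes "norm n = 1"
  shows "det (\<chi> i. reflect n (A $ i)) = - det A"
proof -
  obtain k :: 'n where True by blast
  obtain B :: "real^'n^'n" where B: "orthogonal_matrix B" "B *v axis k 1 = n"
    using orthogonal_matrix_exists_basis[OF assms] by blast
  define D :: "real^'n^'n" where "D = (\<chi> i j. if i = j then if i = k then -1 else 1 else 0)"
  have D: "det D = - 1"
    by (subst det_diagonal) (simp_all add: D_def prod.If_cases)
  have "det B * det B = 1" using det_orthogonal_matrix[OF B(1)] by auto
  have Bt: "B ** transpose B = mat 1" using B(1) by (simp add: orthogonal_matrix_def)
  have n: "n $ i = B $ i $ k" for i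
    using B(2) by (auto simp: matrix_vector_mult_def axis_def if_distrib cong: if_cong)
  have DB: "(D ** transpose B) = transpose B - (\<chi> i j. if i = k then 2 * n $ j else 0)"
    by (simp add: vec_eq_iff matrix_matrix_mult_def D_def transpose_def n if_distribR)
      (simp add: if_distrib if_distribR cong: if_cong)
  have "B ** (D ** transpose B) = mat 1 - (\<chi> i j. 2 * n $ i * n $ j)"
    unfolding DB matrix_diff_ldistrib Bt
    by (simp add: matrix_matrix_mult_def vec_eq_iff n if_distrib[where f = "\<lambda>x. _ * x"] cong: if_cong)
  then have "A ** (B ** (D ** transpose B)) = A - A ** (\<chi> i j. 2 * n $ i * n $ j)"
    by (simp add: matrix_diff_ldistrib)
  also have "\<dots> = (\<chi> i. reflect n (A $ i))"
    by (simp add: reflect_def vec_eq_iff matrix_matrix_mult_def inner_vec_def sum_distrib_left sum_distrib_right mult_ac)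
  finally have "det (\<chi> i. reflect n (A $ i)) = det A * (det B * (det D * det B))"
    by (metis det_mul det_transpose)
  then show ?thesis using D \<open>det B * det B = 1\<close> by simp
qed

context clifford_module begin

text \<open>Inside the Clifford algebra, reflection in the hyperplane orthogonal to \<open>n\<close>
  is the product n v n, since n squares to -1.\<close>

lemma cl_reflect: "norm n = 1 \<Longrightarrow> cl (reflect n v) w = cl n (cl v (cl n w))"
  by (simp add: reflect_def cl_anticommute[of n v] cl_simps cl_cl_same)

text \<open>Between consecutive rows two factors \<open>n\<close> meet and give -1; this happens
  four times, so only the outer two factors remain and no sign.\<close>

lemma row_prod_reflect:
  assumes "norm n = 1"
  shows "row_prod (\<chi> i. reflect n (A $ i)) w = cl n (row_prod A (cl n w))"
proof -
  have [simp]: "cl n (cl n u) = - u" for u by (simp add: cl_cl_same assms)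
  show ?thesis by (simp add: row_prod_def cl_reflect[OF assms] cl_simps)
qed

text \<open>Both sides change sign when a reflection is applied to all rows; reflections move the rows
  one after another to the standard basis.\<close>

lemma row_prod_orthogonal_aux:
  assumes "orthogonal_matrix A" and "\<And>i. i \<in> I \<Longrightarrow> A $ i = axis i 1"
  shows "row_prod A w = det A *\<^sub>R vol w"
  using assms
\<comment> \<open>\<open>I\<close> collects rows already in standard position; the induction counts
  the others.\<close>
proof (induction "card (- I)" arbitrary: A I w)
  case 0
  then have "A = mat 1" by (auto simp: vec_eq_iff mat_1_nth)
  then show ?case by (simp add: vol_def)
next
  case (Suc m)
  have "- I \<noteq> {}" using Suc.hyps(2) by auto
  then obtain k where k: "k \<notin> I" by blast
  have m: "m = card (- insert k I)"
    using Suc.hyps(2) k by (simp add: Compl_insert)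
  have orth: "A $ i \<bullet> A $ j = (if i = j then 1 else 0)" for i j
    using Suc.prems(1) by (simp add: orthogonal_matrix_iff_rows)
  show ?case
  proof (cases "A $ k = axis k 1")
    case True
    show ?thesis by (rule Suc.hyps(1)[OF m Suc.prems(1)]) (use True Suc.prems(2) in auto)
  next
    case False
    \<comment> \<open>\<open>n\<close> is the unit normal of the mirror exchanging row
      \<open>k\<close> with \<open>axis k 1\<close>.\<close>
    define d where "d = norm (A $ k - axis k 1)"
    define n where "n = (1 / d) *\<^sub>R (A $ k - axis k 1)"
    have d: "d > 0" using False by (simp add: d_def)
    have n: "norm n = 1" using d by (simp add: n_def d_def)
    define B where "B = (\<chi> i. reflect n (A $ i))"
    have d2: "d\<^sup>2 = 2 - 2 * (A $ k $ k)"
      unfolding d_def power2_norm_eq_inner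
      by (simp add: inner_diff orth inner_axis inner_axis_axis inner_commute[of "axis k 1"])
    have "B $ i \<bullet> B $ j = A $ i \<bullet> A $ j" for i j
      using n unfolding B_def reflect_def norm_eq_1
      by (simp add: inner_diff algebra_simps inner_commute)
    then have "B $ i \<bullet> B $ j = (if i = j then 1 else 0)" for i j
      by (simp add: orth)
    then have B: "orthogonal_matrix B"
      by (simp add: orthogonal_matrix_iff_rows)
    have "B $ k = axis k 1"
    proof -
      have "n \<bullet> A $ k = (1 - A $ k $ k) / d"
        by (simp add: n_def inner_diff orth inner_axis inner_commute[of "axis k 1"])
      then have "d * (2 * (n \<bullet> A $ k)) = d * d" using d d2 by (simp add: power2_eq_square)
      then have "2 * (n \<bullet> A $ k) = d" using d by simp
      moreover have "d *\<^sub>R n = A $ k - axis k 1" using d by (simp add: n_def)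
      ultimately show ?thesis by (simp add: B_def reflect_def)
    qed
    \<comment> \<open>Rows in standard position are orthogonal to both vectors defining
      \<open>n\<close>, so the reflection fixes them.\<close>
    moreover have "B $ i = axis i 1" if "i \<in> I" for i
    proof -
      have "i \<noteq> k" using that k by auto
      then have "n \<bullet> A $ i = 0"
        using Suc.prems(2)[OF that] orth[of k i] by (simp add: n_def inner_diff inner_axis_axis)
      then show ?thesis using Suc.prems(2)[OF that] by (simp add: B_def reflect_def)
    qed
    ultimately have "row_prod B w = det B *\<^sub>R vol w" for w
      by (intro Suc.hyps(1)[OF m B]) auto
    moreover have "det B = - det A" unfolding B_def by (rule det_reflect_rows[OF n])
    ultimately have "cl n (row_prod A (cl n w)) = - (det A *\<^sub>R vol w)" for w
      using row_prod_reflect[OF n, of A w] by (simp add: B_def)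
    \<comment> \<open>The outer factors are removed by multiplying with \<open>n\<close> on both
      sides; \<open>vol\<close> commutes with \<open>n\<close>, so the two factors on the right also
      cancel.\<close>
    from arg_cong[OF this[of "cl n w"], of "cl n"]
    show ?thesis by (simp add: cl_cl_same n cl_simps vol_cl row_prod_def)
  qed
qed


lemma row_prod_orthogonal: "orthogonal_matrix A \<Longrightarrow> row_prod A w = det A *\<^sub>R vol w"
  by (rule row_prod_orthogonal_aux[where I = "{}"]) auto

end

section \<open>The distinguished spinors and the action of infinitesimal rotations\<close>

context clifford_module begin

lemma vol_inner_self: "vol w \<bullet> w = 0"
  using vol_skew[of w w] by (simp add: inner_commute)

definition anticommuting_structure :: "('w \<Rightarrow> 'w) \<Rightarrow> bool" where
  "anticommuting_structure j \<longleftrightarrow> linear j \<and> (\<forall>w. norm (j w) = norm w) \<and> (\<forall>w. j (j w) = - w) \<and>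
    (\<forall>v w. j (cl v w) = - cl v (j w))"

text \<open>An isometry with square -1 is skew, and passing five vectors makes it anticommute with
  \<open>vol\<close>. Each orthogonality then holds because the expression is \<langle>w, T
  w\<rangle> for a skew operator T.\<close>

lemma
  assumes "anticommuting_structure j"
  shows anticommuting_skew: "j u \<bullet> v = - (u \<bullet> j v)"
    and anticommuting_vol: "j (vol w) = - vol (j w)"
    and cl_inner_anticommuting: "cl r w \<bullet> j w = 0"
    and vol_inner_anticommuting: "vol w \<bullet> j w = 0"
    and cl_inner_vol_anticommuting: "cl r w \<bullet> vol (j w) = 0"
proof -
  have j: "linear j" "\<And>w. norm (j w) = norm w" "\<And>w. j (j w) = - w" "\<And>v w. j (cl v w) = - cl v (j w)"
    using assms by (auto simp: anticommuting_structure_def)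
  have j_inner: "j u \<bullet> j v = u \<bullet> v" for u v
    using j(2)[of "u + v"] j(2)[of u] j(2)[of v]
    by (simp add: linear_add[OF j(1)] norm_eq_sqrt_inner inner_add inner_commute)
  show j_skew: "j u \<bullet> v = - (u \<bullet> j v)" for u v
    using j_inner[of u "j v"] j(3)[of v] by simp
  show j_vol: "j (vol w) = - vol (j w)" for w
    by (simp add: vol_eq j(4) cl_simps)
  show "vol w \<bullet> j w = 0"
    using j_skew[of "vol w" w] vol_skew[of "j w" w] by (simp add: j_vol inner_commute)
  show "cl r w \<bullet> j w = 0"
    using j_skew[of "cl r w" w] cl_skew[of r "j w" w] by (simp add: j(4) inner_commute)
  have "vol (cl r w) \<bullet> j w = cl r w \<bullet> vol (j w)"
    using j_skew[of "cl r (vol w)" w] cl_skew[of r "vol (j w)" w]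
    by (simp add: vol_cl j(4) j_vol cl_simps inner_commute)
  then show "cl r w \<bullet> vol (j w) = 0" using vol_skew[of "cl r w" "j w"] by simp
qed

text \<open>The remainder \<open>p\<close> is orthogonal to all four distinguished spinors, hence
  lies in the image of \<open>E\<close>; as \<open>r\<close> is orthogonal to \<open>E\<close>, it
  is also orthogonal to that image, so it vanishes.\<close>

lemma vol_parallel_of_orthogonal:
  assumes j: "anticommuting_structure j"
    and E: "(\<lambda>v. cl v \<eta>) ` E = (span {\<eta>, vol \<eta>, j \<eta>, vol (j \<eta>)})\<^sup>\<bottom>"
    and r: "\<And>v. v \<in> E \<Longrightarrow> r \<bullet> v = 0" and \<eta>: "norm \<eta> = 1"
  shows "cl r \<eta> = (cl r \<eta> \<bullet> vol \<eta>) *\<^sub>R vol \<eta>"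
proof -
  define p where "p = cl r \<eta> - (cl r \<eta> \<bullet> vol \<eta>) *\<^sub>R vol \<eta>"
  define B where "B = {\<eta>, vol \<eta>, j \<eta>, vol (j \<eta>)}"
  have one: "\<eta> \<bullet> \<eta> = 1" using \<eta> by (simp add: norm_eq_1)
  have "\<eta> \<bullet> j \<eta> = 0"
    using anticommuting_skew[OF j, of \<eta> \<eta>] by (simp add: inner_commute)
  then have "\<eta> \<bullet> p = 0" "vol \<eta> \<bullet> p = 0" "j \<eta> \<bullet> p = 0" "vol (j \<eta>) \<bullet> p = 0"
    using cl_inner_same[of r \<eta>] cl_inner_anticommuting[OF j, of r \<eta>] vol_inner_self[of \<eta>]
      cl_inner_vol_anticommuting[OF j, of r \<eta>] vol_inner_anticommuting[OF j, of \<eta>]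
      vol_inner_vol[of \<eta> \<eta>] vol_inner_vol[of \<eta> "j \<eta>"] one
    by (simp_all add: p_def inner_diff_right inner_commute)
  then have p_orth: "w \<bullet> p = 0" if "w \<in> B" for w
    using that by (auto simp: B_def)
  have "w \<bullet> p = 0" if "w \<in> span B" for w
    using that
    by (rule span_induct) (auto simp: p_orth subspace_def inner_add_left)
  then have "p \<in> (span B)\<^sup>\<bottom>"
    by (simp add: orthogonal_comp_def orthogonal_def)
  moreover have "p \<in> ((span B)\<^sup>\<bottom>)\<^sup>\<bottom>"
  proof -
    have "w \<bullet> cl r \<eta> = 0" if w: "w \<in> (span B)\<^sup>\<bottom>" for w
    proof -
      obtain v where "v \<in> E" "w = cl v \<eta>" using w E B_def by auto
      then show ?thesis using r[of v] by (simp add: cl_inner_cl inner_commute)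
    qed
    moreover have "w \<bullet> vol \<eta> = 0" if w: "w \<in> (span B)\<^sup>\<bottom>" for w
      using w span_base[of "vol \<eta>" B] by (auto simp: orthogonal_comp_def orthogonal_def B_def inner_commute)
    ultimately show ?thesis
      by (auto simp: orthogonal_comp_def orthogonal_def p_def inner_diff_right)
  qed
  ultimately have "p \<bullet> p = 0" by (auto simp: orthogonal_comp_def orthogonal_def)
  then show ?thesis by (simp add: p_def)
qed

text \<open>The Clifford product of the positive orthonormal basis X, X', Y, Y', r on \<eta> is
  computed twice: it is \<open>vol\<close>, and successive evaluation on \<eta> gives - \<epsilon>
  times the same spinor.\<close>

lemma vol_sign_of_oriented_basis:
  assumes \<eta>: "norm \<eta> = 1" and r: "r \<bullet> r = 1" and \<epsilon>: "cl r \<eta> = \<epsilon> *\<^sub>R vol \<eta>"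
    and X: "X \<bullet> X = 1" "X \<bullet> r = 0" "cl X' \<eta> = vol (cl X \<eta>)"
    and Y: "Y \<bullet> Y = 1" "Y \<bullet> r = 0" "Y \<bullet> X = 0" "Y \<bullet> X' = 0" "cl Y' \<eta> = vol (cl Y \<eta>)"
    and A: "A $ 1 = X" "A $ 2 = X'" "A $ 3 = Y" "A $ 4 = Y'" "A $ 5 = r" and "det A > 0"
  shows "\<epsilon> = - 1"
proof -
  have one: "\<eta> \<bullet> \<eta> = 1" using \<eta> by (simp add: norm_eq_1)
  have inner: "u \<bullet> v = cl u \<eta> \<bullet> cl v \<eta>" for u v by (simp add: cl_inner_cl one)
  have "X' \<bullet> X' = 1" "Y' \<bullet> Y' = 1"
    using X(1) Y(1) unfolding inner X(3) Y(5) by (simp_all add: vol_inner_vol)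
  moreover have "X' \<bullet> X = 0" "Y' \<bullet> Y = 0"
    unfolding inner X(3) Y(5) by (simp_all add: vol_inner_self)
  moreover have "X' \<bullet> r = 0" "Y' \<bullet> r = 0"
    unfolding inner X(3) Y(5) \<epsilon> by (simp_all add: vol_inner_vol cl_inner_same)
  moreover have "Y' \<bullet> X = 0"
  proof -
    have "Y' \<bullet> X = - (cl Y \<eta> \<bullet> vol (cl X \<eta>))" unfolding inner Y(5) by (rule vol_skew)
    also have "\<dots> = - (Y \<bullet> X')" by (simp only: X(3)[symmetric] inner)
    finally show ?thesis using Y(4) by simp
  qed
  moreover have "Y' \<bullet> X' = 0"
  proof -
    have "Y' \<bullet> X' = Y \<bullet> X" unfolding inner X(3) Y(5) by (rule vol_inner_vol)
    then show ?thesis using Y(3) by simp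
  qed
  ultimately have "A $ i \<bullet> A $ j = (if i = j then 1 else 0)" for i j
    using X Y r exhaust_5[of i] exhaust_5[of j] by (auto simp: A inner_commute simp del: one_neq_zero)
  then have orth: "orthogonal_matrix A" by (simp add: orthogonal_matrix_iff_rows)
  then have "det A = 1" using det_orthogonal_matrix[OF orth] \<open>det A > 0\<close> by auto
  then have "row_prod A \<eta> = vol \<eta>" using row_prod_orthogonal[OF orth] by simp
  moreover have "row_prod A \<eta> = - \<epsilon> *\<^sub>R vol \<eta>"
  proof -
    have sq: "cl X (cl X w) = - w" "cl Y (cl Y w) = - w" for w
      using X(1) Y(1) by (simp_all add: cl_cl_same power2_norm_eq_inner)
    \<comment> \<open>After \<open>r\<close> produces \<open>vol \<eta>\<close>, the pair Y, Y' acts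
      on it to give \<eta>, and the pair X, X' then takes \<eta> to
      \<open>- vol \<eta>\<close>.\<close>
    have "cl Y' (vol \<eta>) = - cl Y \<eta>" by (simp flip: vol_cl add: Y(5) vol_vol)
    then show ?thesis
      by (simp add: row_prod_def A \<epsilon> cl_simps vol_simps sq X(3) flip: vol_cl)
  qed
  moreover have "vol \<eta> \<noteq> 0" using vol_inner_vol[of \<eta> \<eta>] one by auto
  ultimately show ?thesis by (metis scaleR_cancel_right scaleR_one minus_equation_iff)
qed

text \<open>Evaluates the connection term of the spin connection. Let B be that quadratic sum. Its
  commutator with \<open>r\<close> is multiplication by four times the rotated vector \<rho>, while
  skewness of B and \<open>vol\<close> expresses the same pairing with the opposite sign of the r B
  term; adding the two eliminates this term.\<close>

lemma vol_rotation_inner: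
  fixes G :: "5 \<Rightarrow> 5 \<Rightarrow> real"
  assumes skew: "\<And>i j. G i j = - G j i" and r: "vol \<eta> = - cl r \<eta>" and \<eta>: "norm \<eta> = 1"
  shows "vol (\<Sum>i\<in>UNIV. \<Sum>j\<in>UNIV. G i j *\<^sub>R cl (axis i 1) (cl (axis j 1) \<eta>)) \<bullet> cl w \<eta>
    = - 2 * (\<Sum>i\<in>UNIV. \<Sum>j\<in>UNIV. G i j * (r $ i) * (w $ j))"
proof -
  define B where "B \<psi> = (\<Sum>i\<in>UNIV. \<Sum>j\<in>UNIV. G i j *\<^sub>R cl (axis i 1) (cl (axis j 1) \<psi>))" for \<psi>
  define \<rho> where "\<rho> = (\<chi> j. \<Sum>i\<in>UNIV. G i j * r $ i)"
  have G_sum: "(\<Sum>i\<in>UNIV. \<Sum>j\<in>UNIV. G i j * f i j) = - (\<Sum>i\<in>UNIV. \<Sum>j\<in>UNIV. G i j * f j i)" for f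
  proof -
    have "(\<Sum>i\<in>UNIV. \<Sum>j\<in>UNIV. G i j * f i j) = (\<Sum>i\<in>UNIV. \<Sum>j\<in>UNIV. G j i * f j i)"
      by (rule sum.swap)
    also have "\<dots> = (\<Sum>i\<in>UNIV. \<Sum>j\<in>UNIV. - (G i j * f j i))"
      by (intro sum.cong refl) (subst skew, simp)
    finally show ?thesis by (simp add: sum_negf)
  qed
  have vol_B: "vol (B \<psi>) = B (vol \<psi>)" for \<psi> by (simp add: B_def vol_simps vol_cl)
  have B_neg: "B (- \<psi>) = - B \<psi>" for \<psi> by (simp add: B_def cl_simps sum_negf)
  have B_skew: "B \<psi> \<bullet> \<psi>' = - (\<psi> \<bullet> B \<psi>')" for \<psi> \<psi>'
  proof -
    have "B \<psi> \<bullet> \<psi>' = (\<Sum>i\<in>UNIV. \<Sum>j\<in>UNIV. G i j * (\<psi> \<bullet> cl (axis j 1) (cl (axis i 1) \<psi>')))"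
      by (simp add: B_def inner_sum_left cl_skew)
    also have "\<dots> = - (\<psi> \<bullet> B \<psi>')" by (subst G_sum) (simp add: B_def inner_sum_right)
    finally show ?thesis .
  qed
  have "(\<Sum>i\<in>UNIV. \<Sum>j\<in>UNIV. G i j * (r $ j * (cl (axis i 1) \<eta> \<bullet> v))) = - (cl \<rho> \<eta> \<bullet> v)" for v
  proof -
    have "\<rho> = (\<Sum>j\<in>UNIV. (\<Sum>i\<in>UNIV. G i j * r $ i) *\<^sub>R axis j 1)"
      by (simp add: \<rho>_def vec_eq_iff axis_def if_distrib cong: if_cong)
    then have "cl \<rho> \<eta> \<bullet> v = (\<Sum>j\<in>UNIV. \<Sum>i\<in>UNIV. G i j * (r $ i * (cl (axis j 1) \<eta> \<bullet> v)))"
      by (simp add: linear_sum[OF linear_cl_left] cl_simps inner_sum_left sum_distrib_right mult.assoc)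
    then show ?thesis by (subst G_sum) (subst sum.swap, simp)
  qed
  moreover have "(\<Sum>i\<in>UNIV. \<Sum>j\<in>UNIV. G i j * (r $ i * (cl (axis j 1) \<eta> \<bullet> v))) = cl \<rho> \<eta> \<bullet> v" for v
    using calculation[of v] by (subst G_sum) simp
  moreover have "cl (axis i 1) (cl (axis j 1) (cl r \<eta>))
      = cl r (cl (axis i 1) (cl (axis j 1) \<eta>)) + (2 * r $ i) *\<^sub>R cl (axis j 1) \<eta> - (2 * r $ j) *\<^sub>R cl (axis i 1) \<eta>"
    for i j
    by (simp add: cl_anticommute[of _ r] cl_simps inner_axis inner_commute)
  \<comment> \<open>The two correction terms of the commutation rule contribute 2 \<rho> each, the
    second after an index swap that uses the skewness of \<open>G\<close>.\<close>
  ultimately have B_cl: "B (cl r \<eta>) \<bullet> v = cl r (B \<eta>) \<bullet> v + 4 * (cl \<rho> \<eta> \<bullet> v)" for v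
    by (simp add: B_def cl_simps inner_sum_left inner_add_left inner_diff_left
        distrib_left right_diff_distrib sum.distrib sum_subtractf mult.assoc mult.left_commute[of _ 2]
        flip: sum_distrib_left)
  have "vol (B \<eta>) \<bullet> cl w \<eta> = - (cl r (B \<eta>) \<bullet> cl w \<eta>) - 4 * (\<rho> \<bullet> w)"
    using B_cl[of "cl w \<eta>"] \<eta> by (simp add: vol_B r B_neg cl_inner_cl norm_eq_1)
  \<comment> \<open>The second expression: \<open>vol\<close> is moved to the other side, and
    exchanging \<open>w\<close> with \<open>r\<close> costs only a multiple of \<eta>, to which
    \<open>B \<eta>\<close> is orthogonal.\<close>
  moreover have "vol (B \<eta>) \<bullet> cl w \<eta> = cl r (B \<eta>) \<bullet> cl w \<eta>"
  proof -
    have "B \<eta> \<bullet> \<eta> = 0" using B_skew[of \<eta> \<eta>] by (simp add: inner_commute)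
    have "vol (B \<eta>) \<bullet> cl w \<eta> = B \<eta> \<bullet> cl w (cl r \<eta>)"
      by (simp add: vol_skew vol_cl r cl_simps)
    also have "\<dots> = - (B \<eta> \<bullet> cl r (cl w \<eta>))"
      using \<open>B \<eta> \<bullet> \<eta> = 0\<close> by (simp add: cl_anticommute[of w r] inner_diff_right)
    finally show ?thesis by (simp add: cl_skew)
  qed
  ultimately have "vol (B \<eta>) \<bullet> cl w \<eta> = - 2 * (\<rho> \<bullet> w)" by simp
  also have "\<rho> \<bullet> w = (\<Sum>i\<in>UNIV. \<Sum>j\<in>UNIV. G i j * (r $ i) * (w $ j))"
    by (subst sum.swap) (simp add: \<rho>_def inner_vec_def sum_distrib_right)
  finally show ?thesis by (simp add: B_def)
qed
end

section \<open>Families of bilinear forms\<close>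

lemma differentiable_if_smooth_on: "smooth_on S f \<Longrightarrow> x \<in> S \<Longrightarrow> f differentiable (at x)"
  unfolding smooth_on_def by (drule spec[of _ "Suc 0"]) simp

lemma bilinear_expand:
  assumes "bilinear (h :: real^'n \<Rightarrow> real^'n \<Rightarrow> real)"
  shows "h s t = (\<Sum>k\<in>UNIV. \<Sum>l\<in>UNIV. (s $ k) * (t $ l) * h (axis k 1) (axis l 1))"
proof -
  have "s = (\<Sum>k\<in>UNIV. (s $ k) *\<^sub>R axis k 1)" for s :: "real^'n"
    using basis_expansion[of s] by (simp add: scalar_mult_eq_scaleR)
  then have "h s t = h (\<Sum>k\<in>UNIV. (s $ k) *\<^sub>R axis k 1) (\<Sum>l\<in>UNIV. (t $ l) *\<^sub>R axis l 1)"
    by presburger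
  also have "\<dots> = (\<Sum>k\<in>UNIV. \<Sum>l\<in>UNIV. (s $ k) * (t $ l) * h (axis k 1) (axis l 1))"
    by (simp add: bilinear_sum[OF assms] bilinear_lmul[OF assms] bilinear_rmul[OF assms]
        sum.cartesian_product mult_ac)
  finally show ?thesis .
qed

text \<open>Models the coefficients of a metric in a chart near one point; \<open>dm\<close> below
  is then the array of their partial derivatives.\<close>

locale bilinear_family =
  fixes U :: "'a::real_normed_vector set" and p :: 'a and m :: "'a \<Rightarrow> real^'n \<Rightarrow> real^'n \<Rightarrow> real"
  assumes U: "open U" "p \<in> U"
    and bilinear_m: "y \<in> U \<Longrightarrow> bilinear (m y)"
    and m_differentiable: "(\<lambda>y. m y s t) differentiable (at p)"
begin

definition dm :: "'a \<Rightarrow> real^'n \<Rightarrow> real^'n \<Rightarrow> real" where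
  "dm u s t = frechet_derivative (\<lambda>y. m y s t) (at p) u"

lemma has_derivative_m: "((\<lambda>y. m y s t) has_derivative (\<lambda>u. dm u s t)) (at p)"
  unfolding dm_def using m_differentiable[of s t] by (simp add: frechet_derivative_works)

text \<open>Derivatives are unique and local, so algebraic identities valid on \<open>U\<close> can
  be differentiated; linearity and symmetry of \<open>dm\<close> come from this.\<close>

lemma dm_eqI: "(f has_derivative f') (at p) \<Longrightarrow> (\<And>y. y \<in> U \<Longrightarrow> f y = m y s t) \<Longrightarrow> dm u s t = f' u"
proof -
  assume f: "(f has_derivative f') (at p)" and eq: "\<And>y. y \<in> U \<Longrightarrow> f y = m y s t"
  have "((\<lambda>y. m y s t) has_derivative f') (at p)"
    by (rule has_derivative_transform_within_open[OF f U eq])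
  then show ?thesis by (metis has_derivative_m has_derivative_unique)
qed

lemma linear_dm1: "linear (\<lambda>u. dm u s t)"
  unfolding dm_def by (rule linear_frechet_derivative[OF m_differentiable])

lemma linear_dm2: "linear (\<lambda>s. dm u s t)"
proof (rule linearI)
  show "dm u (s + s') t = dm u s t + dm u s' t" for s s'
    by (rule dm_eqI[of "\<lambda>y. m y s t + m y s' t"])
      (auto intro!: derivative_eq_intros has_derivative_m simp: bilinear_ladd[OF bilinear_m])
  show "dm u (c *\<^sub>R s) t = c *\<^sub>R dm u s t" for c s
    by (rule dm_eqI[of "\<lambda>y. c * m y s t"])
      (auto intro!: derivative_eq_intros has_derivative_m simp: bilinear_lmul[OF bilinear_m])
qed

lemma linear_dm3: "linear (dm u s)"
proof (rule linearI)
  show "dm u s (t + t') = dm u s t + dm u s t'" for t t'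
    by (rule dm_eqI[of "\<lambda>y. m y s t + m y s t'"])
      (auto intro!: derivative_eq_intros has_derivative_m simp: bilinear_radd[OF bilinear_m])
  show "dm u s (c *\<^sub>R t) = c *\<^sub>R dm u s t" for c t
    by (rule dm_eqI[of "\<lambda>y. c * m y s t"])
      (auto intro!: derivative_eq_intros has_derivative_m simp: bilinear_rmul[OF bilinear_m])
qed

text \<open>Differentiability is given only for fixed vector arguments, so the moving arguments are
  first expanded in the standard basis.\<close>

lemma has_derivative_product:
  assumes F: "(F has_derivative F') (at p)" and H: "(H has_derivative H') (at p)"
  shows "((\<lambda>y. m y (F y) (H y)) has_derivative
    (\<lambda>u. dm u (F p) (H p) + m p (F' u) (H p) + m p (F p) (H' u))) (at p)"
proof -
  have nth: "((\<lambda>y. G y $ k) has_derivative (\<lambda>u. G' u $ k)) (at p)"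
    if "(G has_derivative G') (at p)" for G G' and k :: 'n
    using bounded_linear.has_derivative[OF bounded_linear_vec_nth that] .
  have dm: "bilinear (dm u)" for u
    using linear_dm2 linear_dm3 by (auto simp: bilinear_def)
  have m: "bilinear (m p)" using bilinear_m U by blast
  have "((\<lambda>y. \<Sum>k\<in>UNIV. \<Sum>l\<in>UNIV. (F y $ k) * (H y $ l) * m y (axis k 1) (axis l 1)) has_derivative
    (\<lambda>u. \<Sum>k\<in>UNIV. \<Sum>l\<in>UNIV. (F p $ k) * (H p $ l) * dm u (axis k 1) (axis l 1)
      + ((F' u $ k) * (H p $ l) + (F p $ k) * (H' u $ l)) * m p (axis k 1) (axis l 1))) (at p)"
    by (intro has_derivative_sum) (auto intro!: derivative_eq_intros nth F H has_derivative_m simp: algebra_simps)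
  also have "(\<lambda>u. \<Sum>k\<in>UNIV. \<Sum>l\<in>UNIV. (F p $ k) * (H p $ l) * dm u (axis k 1) (axis l 1)
      + ((F' u $ k) * (H p $ l) + (F p $ k) * (H' u $ l)) * m p (axis k 1) (axis l 1))
    = (\<lambda>u. dm u (F p) (H p) + m p (F' u) (H p) + m p (F p) (H' u))"
    by (rule ext) (simp add: bilinear_expand[OF dm, of _ "F p" "H p"] sum.distrib distrib_right
        bilinear_expand[OF m, of "F' _" "H p"] bilinear_expand[OF m, of "F p" "H' _"])
  finally show ?thesis
    by (rule has_derivative_transform_within_open[OF _ U]) (rule bilinear_expand[OF bilinear_m, symmetric])
qed

end

section \<open>Charts\<close>

locale oriented_manifold =
  fixes A :: "'m::topological_space chart set"
  assumes atlas: "oriented_atlas A"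
begin

lemma chart_homeomorphism:
  "c \<in> A \<Longrightarrow> homeomorphism (fst c) (snd c ` fst c) (snd c) (cinv c)"
  and open_chart_domain: "c \<in> A \<Longrightarrow> open (fst c)"
  and open_chart_image: "c \<in> A \<Longrightarrow> open (snd c ` fst c)"
  using atlas unfolding oriented_atlas_def by blast+

lemma cinv_chart: "c \<in> A \<Longrightarrow> q \<in> fst c \<Longrightarrow> cinv c (snd c q) = q"
  by (rule homeomorphism_apply1[OF chart_homeomorphism])

lemma open_chart_image_Int:
  assumes "c \<in> A" "open U" shows "open (snd c ` (fst c \<inter> U))"
proof -
  have "openin (top_of_set (snd c ` fst c)) (snd c ` (fst c \<inter> U))"
    using assms by (intro homeomorphism_imp_open_map[OF chart_homeomorphism]) (auto simp: openin_open)
  then show ?thesis using open_chart_image[OF assms(1)] openin_open_trans by blast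
qed

lemma chart_at: "chart_at A q \<in> A" "q \<in> fst (chart_at A q)"
proof -
  have "\<exists>c. c \<in> A \<and> q \<in> fst c" using atlas unfolding oriented_atlas_def by blast
  then have "chart_at A q \<in> A \<and> q \<in> fst (chart_at A q)"
    unfolding chart_at_def by (rule someI_ex)
  then show "chart_at A q \<in> A" "q \<in> fst (chart_at A q)" by auto
qed

lemma transition_differentiable:
  assumes "c \<in> A" "d \<in> A" "q \<in> fst c" "q \<in> fst d"
  shows "(snd d \<circ> cinv c) differentiable (at (snd c q))"
  by (rule differentiable_if_smooth_on[of "snd c ` (fst c \<inter> fst d)"])
    (use assms atlas in \<open>auto simp: oriented_atlas_def\<close>)

lemma linear_from_chart: "c \<in> A \<Longrightarrow> q \<in> fst c \<Longrightarrow> linear (from_chart A c q)"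
  unfolding from_chart_def
  by (intro linear_frechet_derivative transition_differentiable) (simp_all add: chart_at)

lemma frechet_derivative_self_transition:
  assumes "c \<in> A" "q \<in> fst c"
  shows "frechet_derivative (snd c \<circ> cinv c) (at (snd c q)) = (\<lambda>v. v)"
proof -
  have "frechet_derivative (\<lambda>y. y) (at (snd c q)) = frechet_derivative (snd c \<circ> cinv c) (at (snd c q))"
  proof (rule frechet_derivative_transform_within_open[OF _ open_chart_image[OF assms(1)]])
    show "y = (snd c \<circ> cinv c) y" if "y \<in> snd c ` fst c" for y
      using that assms(1) by (auto simp: cinv_chart)
  qed (use assms in auto)
  then show ?thesis by simp
qed

text \<open>The chain rule for two mutually inverse transition maps, whose composite is the identity
  near the point.\<close>

lemma from_chart_to_chart:
  assumes c: "c \<in> A" "q \<in> fst c"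
  shows "from_chart A c q (to_chart A c q v) = v"
proof -
  define d where "d = chart_at A q"
  have d: "d \<in> A" "q \<in> fst d" by (simp_all add: d_def chart_at)
  have cd: "cinv d (snd d q) = q" by (rule cinv_chart[OF d])
  have "frechet_derivative ((snd d \<circ> cinv c) \<circ> (snd c \<circ> cinv d)) (at (snd d q)) =
      frechet_derivative (snd d \<circ> cinv c) (at ((snd c \<circ> cinv d) (snd d q))) \<circ>
      frechet_derivative (snd c \<circ> cinv d) (at (snd d q))"
    using transition_differentiable[OF c(1) d(1) c(2) d(2)] transition_differentiable[OF d(1) c(1) d(2) c(2)]
    by (intro frechet_derivative_compose) (simp_all add: cd)
  moreover have "frechet_derivative (\<lambda>y. y) (at (snd d q)) =
      frechet_derivative ((snd d \<circ> cinv c) \<circ> (snd c \<circ> cinv d)) (at (snd d q))"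
  proof (rule frechet_derivative_transform_within_open)
    show "open (snd d ` (fst d \<inter> fst c))"
      by (rule open_chart_image_Int[OF d(1) open_chart_domain[OF c(1)]])
    show "y = ((snd d \<circ> cinv c) \<circ> (snd c \<circ> cinv d)) y" if "y \<in> snd d ` (fst d \<inter> fst c)" for y
      using that c(1) d(1) by (auto simp: cinv_chart)
  qed (use c(2) d(2) in auto)
  ultimately have "(\<lambda>y. y) = frechet_derivative (snd d \<circ> cinv c) (at (snd c q)) \<circ>
      frechet_derivative (snd c \<circ> cinv d) (at (snd d q))"
    by (simp add: cd)
  then have "v = frechet_derivative (snd d \<circ> cinv c) (at (snd c q))
      (frechet_derivative (snd c \<circ> cinv d) (at (snd d q)) v)"
    by (metis comp_apply)
  then show ?thesis
    by (simp add: from_chart_def to_chart_def deriv_along_def d_def)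
qed

text \<open>A tangent vector at \<open>q\<close> is by convention its component vector in
  \<open>chart_at A q\<close>, so the conversions for that chart are trivial at \<open>q\<close>
  itself.\<close>

lemma from_chart_at: "from_chart A (chart_at A q) q v = v"
  unfolding from_chart_def frechet_derivative_self_transition[OF chart_at] ..

lemma to_chart_at: "to_chart A (chart_at A q) q v = v"
  unfolding to_chart_def deriv_along_def frechet_derivative_self_transition[OF chart_at] ..

end

section \<open>The spin connection in a chart\<close>

locale spin_manifold_patch =
  fixes M :: "('m::{t2_space,second_countable_topology}, 'i, 'w::euclidean_space) spin_data" and a :: 'i
  assumes spin: "spin_manifold M"
begin

sublocale oriented_manifold "atl M"
  using spin by unfold_locales (simp add: spin_manifold_def)

sublocale clifford_module "cl M"
  using spin by unfold_locales (simp add: spin_manifold_def)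

lemma riemannian: "riemannian_metric (atl M) (met M)"
  and open_patch: "open (patch M a)"
  and smooth_frame: "smooth_vf (atl M) (patch M a) (\<lambda>x. frame M a x i)"
  using spin by (simp_all add: spin_manifold_def)

lemma frame_orthonormal: "q \<in> patch M a \<Longrightarrow> met M q (frame M a q i) (frame M a q j) = (if i = j then 1 else 0)"
  and frame_positive: "q \<in> patch M a \<Longrightarrow> positive_basis (frame M a q)"
  using spin unfolding spin_manifold_def by blast+

lemma bilinear_met: "bilinear (met M q)" and met_commute: "met M q u v = met M q v u"
  using riemannian unfolding riemannian_metric_def by blast+

lemmas met_simps = bilinear_ladd[OF bilinear_met] bilinear_radd[OF bilinear_met]
  bilinear_lmul[OF bilinear_met] bilinear_rmul[OF bilinear_met]
  bilinear_lneg[OF bilinear_met] bilinear_rneg[OF bilinear_met]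
  bilinear_lsub[OF bilinear_met] bilinear_rsub[OF bilinear_met]
  bilinear_lzero[OF bilinear_met] bilinear_rzero[OF bilinear_met]

text \<open>Components in the orthonormal frame: an isometry onto Euclidean space that turns
  \<open>cmult\<close> into \<open>cl\<close>, so the algebra above applies fibrewise.\<close>

definition coords :: "'m \<Rightarrow> real^5 \<Rightarrow> real^5" where
  "coords q v = (\<chi> i. met M q v (frame M a q i))"

lemma cmult_coords: "cmult M a q v = cl M (coords q v)"
  by (simp add: cmult_def coords_def)

lemma linear_coords: "linear (coords q)"
  by (rule linearI) (simp_all add: coords_def vec_eq_iff met_simps)

lemma met_sum_left: "met M q (\<Sum>i\<in>I. f i) v = (\<Sum>i\<in>I. met M q (f i) v)"
proof -
  have "linear (\<lambda>u. met M q u v)" using bilinear_met by (simp add: bilinear_def)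
  from linear_sum[OF this] show ?thesis .
qed

lemma coords_frame: "q \<in> patch M a \<Longrightarrow> coords q (frame M a q i) = axis i 1"
  by (simp add: coords_def vec_eq_iff frame_orthonormal axis_def)

lemma coords_sum_frame: "q \<in> patch M a \<Longrightarrow> coords q (\<Sum>i\<in>UNIV. (c $ i) *\<^sub>R frame M a q i) = c"
  by (simp add: coords_def vec_eq_iff frame_orthonormal met_sum_left met_simps if_distrib cong: if_cong)

text \<open>Positivity of the determinant makes the frame a basis; orthonormality identifies the
  coefficients.\<close>

lemma frame_expansion:
  assumes q: "q \<in> patch M a"
  shows "v = (\<Sum>i\<in>UNIV. (coords q v $ i) *\<^sub>R frame M a q i)"
proof -
  define F :: "real^5^5" where "F = (\<chi> i j. frame M a q j $ i)"
  have "det F \<noteq> 0" using frame_positive[OF q] by (simp add: F_def positive_basis_def)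
  then obtain B where "F ** B = mat 1"
    using invertible_det_nz invertible_right_inverse by blast
  then have "v = F *v (B *v v)" by (simp add: matrix_vector_mul_assoc)
  also have "\<dots> = (\<Sum>i\<in>UNIV. ((B *v v) $ i) *\<^sub>R frame M a q i)"
    by (simp add: F_def matrix_vector_mult_def vec_eq_iff mult.commute)
  finally have v: "v = (\<Sum>i\<in>UNIV. ((B *v v) $ i) *\<^sub>R frame M a q i)" .
  then have "coords q v = B *v v" using coords_sum_frame[OF q] by metis
  then show ?thesis using v by simp
qed

lemma met_coords: "q \<in> patch M a \<Longrightarrow> met M q u v = coords q u \<bullet> coords q v"
  by (subst frame_expansion[of q v])
    (simp_all add: met_commute[of q u] met_sum_left met_simps, simp add: coords_def inner_vec_def met_commute mult.commute)

lemma coords_inject: "q \<in> patch M a \<Longrightarrow> coords q u = coords q v \<longleftrightarrow> u = v"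
  using frame_expansion by metis

lemma vol_mult_eq: "q \<in> patch M a \<Longrightarrow> vol_mult M a q = vol"
  by (simp add: fun_eq_iff vol_mult_def Let_def cmult_coords coords_frame vol_eq)

text \<open>The matrix of \<open>b\<close> is that of the frame times the transposed matrix of frame
  components, and the frame is positive too.\<close>

lemma det_coords:
  assumes q: "q \<in> patch M a" and b: "positive_basis b"
  shows "det (\<chi> i. coords q (b i)) > 0"
proof -
  define F :: "real^5^5" where "F = (\<chi> i j. frame M a q j $ i)"
  define C :: "real^5^5" where "C = (\<chi> i. coords q (b i))"
  have "b j $ i = (\<Sum>k\<in>UNIV. frame M a q k $ i * coords q (b j) $ k)" for i j
    by (subst frame_expansion[OF q, of "b j"]) (simp add: mult.commute)
  then have "(\<chi> i j. b j $ i) = F ** transpose C"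
    by (simp add: F_def C_def vec_eq_iff matrix_matrix_mult_def transpose_def)
  then have "0 < det F * det C"
    using b by (simp add: positive_basis_def det_mul)
  moreover have "det F > 0" using frame_positive[OF q] by (simp add: F_def positive_basis_def)
  ultimately show ?thesis by (simp add: zero_less_mult_iff C_def)
qed

lemma metric_bilinear_family:
  assumes "c \<in> atl M" "q \<in> fst c"
  shows "bilinear_family (snd c ` fst c) (snd c q) (metric_in_chart (atl M) (met M) c)"
proof
  show "open (snd c ` fst c)" "snd c q \<in> snd c ` fst c"
    using assms open_chart_image by auto
  show "bilinear (metric_in_chart (atl M) (met M) c y)" if "y \<in> snd c ` fst c" for y
  proof -
    have "linear (from_chart (atl M) c (cinv c y))"
      using that assms(1) by (auto simp: cinv_chart intro: linear_from_chart)
    note lin = linear_add[OF this] linear_scale[OF this]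
    show ?thesis unfolding bilinear_def metric_in_chart_def
      by (auto intro!: linearI simp: lin met_simps)
  qed
  show "(\<lambda>y. metric_in_chart (atl M) (met M) c y s t) differentiable at (snd c q)" for s t
  proof (rule differentiable_if_smooth_on)
    show "smooth_on (snd c ` fst c) (\<lambda>y. metric_in_chart (atl M) (met M) c y s t)"
      using riemannian assms(1) unfolding riemannian_metric_def by blast
  qed (use assms in auto)
qed

end

section \<open>Connection coefficients at a point, in its own chart\<close>

locale spin_manifold_point = spin_manifold_patch +
  fixes x assumes x: "x \<in> patch M a"
begin

abbreviation "c \<equiv> chart_at (atl M) x"
abbreviation "y0 \<equiv> snd c x"
abbreviation "e \<equiv> frame M a x"

definition frame_in_chart :: "5 \<Rightarrow> real^5 \<Rightarrow> real^5" where
  "frame_in_chart i y = to_chart (atl M) c (cinv c y) (frame M a (cinv c y) i)"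

sublocale bilinear_family "snd c ` fst c" y0 "metric_in_chart (atl M) (met M) c"
  by (rule metric_bilinear_family) (rule chart_at)+

abbreviation "dframe i \<equiv> frechet_derivative (frame_in_chart i) (at y0)"

abbreviation "W \<equiv> snd c ` (fst c \<inter> patch M a)"

lemma W: "open W" "y0 \<in> W"
  using open_chart_image_Int[OF chart_at(1) open_patch] chart_at(2) x by auto

lemma cinv_W: "y \<in> W \<Longrightarrow> cinv c y \<in> patch M a" "y \<in> W \<Longrightarrow> cinv c y \<in> fst c"
  using chart_at(1) by (auto simp: cinv_chart)

lemma cinv_y0: "cinv c y0 = x"
  by (rule cinv_chart[OF chart_at])

lemma metric_y0: "metric_in_chart (atl M) (met M) c y0 = met M x"
  by (simp add: fun_eq_iff metric_in_chart_def cinv_y0 from_chart_at)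

lemma frame_y0: "frame_in_chart i y0 = e i"
  by (simp add: frame_in_chart_def cinv_y0 to_chart_at)

lemma has_derivative_frame: "(frame_in_chart i has_derivative dframe i) (at y0)"
proof -
  have "smooth_on W (frame_in_chart i)"
    using smooth_frame chart_at(1) unfolding smooth_vf_def frame_in_chart_def by blast
  then show ?thesis using W(2) differentiable_if_smooth_on frechet_derivative_works by blast
qed

lemma metric_frame: "y \<in> W \<Longrightarrow> metric_in_chart (atl M) (met M) c y w (frame_in_chart i y)
    = coords (cinv c y) (from_chart (atl M) c (cinv c y) w) $ i"
  by (simp add: metric_in_chart_def frame_in_chart_def coords_def from_chart_to_chart[OF chart_at(1) cinv_W(2)])

definition \<Gamma> :: "real^5 \<Rightarrow> 5 \<Rightarrow> 5 \<Rightarrow> real" where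
  "\<Gamma> u i j = met M x (levi_civita (atl M) (met M) (\<lambda>y. frame M a y i) x u) (e j)"

lemma dm_commute: "dm u s t = dm u t s"
  by (rule dm_eqI[OF has_derivative_m]) (simp add: metric_in_chart_def met_commute)

text \<open>The right-hand side is linear in \<open>w\<close>, so the orthonormal frame represents
  it by a unique vector, which makes the definite description meaningful.\<close>

lemma met_levi_civita:
  "met M x (levi_civita (atl M) (met M) (\<lambda>y. frame M a y i) x u) w =
    met M x (dframe i u) w + (dm u (e i) w + dm (e i) u w - dm w u (e i)) / 2"
proof -
  define L where "L w = met M x (dframe i u) w + (dm u (e i) w + dm (e i) u w - dm w u (e i)) / 2" for w
  have "linear L"
    by (rule linearI) (simp_all add: L_def met_simps linear_add[OF linear_dm3] linear_add[OF linear_dm1]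
      linear_scale[OF linear_dm3] linear_scale[OF linear_dm1] field_simps)
  have ex: "\<exists>!z. \<forall>w. met M x z w = L w"
  proof
    define z where "z = (\<Sum>j\<in>UNIV. L (e j) *\<^sub>R e j)"
    show "\<forall>w. met M x z w = L w"
    proof
      fix w
      have "L w = (\<Sum>j\<in>UNIV. coords x w $ j * L (e j))"
        by (subst frame_expansion[OF x, of w])
          (simp add: linear_sum[OF \<open>linear L\<close>] linear_scale[OF \<open>linear L\<close>])
      then show "met M x z w = L w"
        by (simp add: z_def met_sum_left met_simps coords_def met_commute[of x w] mult.commute)
    qed
    show "z' = z" if "\<forall>w. met M x z' w = L w" for z'
      by (rule iffD1[OF coords_inject[OF x]])
        (simp add: coords_def that \<open>\<forall>w. met M x z w = L w\<close>)
  qed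
  have "levi_civita (atl M) (met M) (\<lambda>y. frame M a y i) x u = (THE z. \<forall>w. met M x z w = L w)"
    unfolding levi_civita_def Let_def L_def dm_def frame_in_chart_def[abs_def] ..
  then show ?thesis using theI'[OF ex] by (simp add: L_def)
qed

text \<open>Metric compatibility: the sum of both coefficients is the derivative of the constant
  g(e_i, e_j), the remaining Christoffel terms cancelling by symmetry.\<close>

lemma \<Gamma>_skew: "\<Gamma> u i j = - \<Gamma> u j i"
proof -
  have "((\<lambda>y. metric_in_chart (atl M) (met M) c y (frame_in_chart i y) (frame_in_chart j y)) has_derivative
    (\<lambda>u. dm u (e i) (e j) + met M x (dframe i u) (e j) + met M x (e i) (dframe j u))) (at y0)"
    using has_derivative_product[OF has_derivative_frame has_derivative_frame]
    by (simp add: metric_y0 frame_y0)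
  moreover have "((\<lambda>y. metric_in_chart (atl M) (met M) c y (frame_in_chart i y) (frame_in_chart j y)) has_derivative
    (\<lambda>u. 0)) (at y0)"
  proof (rule has_derivative_transform_within_open[OF has_derivative_const W])
    show "(if i = j then 1 else 0) =
        metric_in_chart (atl M) (met M) c y (frame_in_chart i y) (frame_in_chart j y)" if "y \<in> W" for y
      using that
      by (simp add: metric_in_chart_def frame_in_chart_def frame_orthonormal[OF cinv_W(1)]
          from_chart_to_chart[OF chart_at(1) cinv_W(2)])
  qed
  ultimately have "(\<lambda>u. dm u (e i) (e j) + met M x (dframe i u) (e j) + met M x (e i) (dframe j u)) = (\<lambda>u. 0)"
    by (rule has_derivative_unique)
  from fun_cong[OF this, of u] show ?thesis
    unfolding \<Gamma>_def met_levi_civita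
    using dm_commute[of u "e i" "e j"] dm_commute[of "e i" u "e j"] dm_commute[of "e j" u "e i"]
    by (simp add: met_commute[of x "e i"] field_simps)
qed

lemma spin_conn_eq:
  "spin_conn M a \<psi> x u = frechet_derivative (\<psi> \<circ> cinv c) (at y0) u
    + (1/4) *\<^sub>R (\<Sum>i\<in>UNIV. \<Sum>j\<in>UNIV. \<Gamma> u i j *\<^sub>R cl M (axis i 1) (cl M (axis j 1) (\<psi> x)))"
  by (simp add: spin_conn_def deriv_along_def \<Gamma>_def cmult_coords coords_frame[OF x])

text \<open>The connection coefficients in \<open>\<nabla>\<psi>\<close> cancel those in the derivative of the coframe.  What
  remains beside the \<open>\<nabla>\<psi>\<close> term is symmetric in \<open>u\<close> and \<open>w\<close>, so it drops out of \<open>d\<alpha>\<close>.\<close>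

lemma frechet_derivative_dual_form:
  assumes smooth: "smooth_fun (atl M) (patch M a) \<psi>"
    and unit: "\<And>q. q \<in> patch M a \<Longrightarrow> norm (\<psi> q) = 1"
    and R: "\<And>q. q \<in> patch M a \<Longrightarrow> vol (\<psi> q) = - cmult M a q (R q) (\<psi> q)"
  shows "frechet_derivative (\<lambda>y. met M (cinv c y) (R (cinv c y)) (from_chart (atl M) c (cinv c y) w)) (at y0) u
    = (\<Sum>i\<in>UNIV. coords x (R x) $ i * ((dm u w (e i) + dm w u (e i) - dm (e i) u w) / 2))
      - 2 * (vol (spin_conn M a \<psi> x u) \<bullet> cmult M a x w (\<psi> x))"
proof -
  define N where "N = \<psi> \<circ> cinv c"
  define dN where "dN = frechet_derivative N (at y0)"
  define B where "B = (\<Sum>i\<in>UNIV. \<Sum>j\<in>UNIV. \<Gamma> u i j *\<^sub>R cl M (axis i 1) (cl M (axis j 1) (\<psi> x)))"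
  define r where "r = coords x (R x)"
  define wx where "wx = coords x w"
  have N0: "N y0 = \<psi> x" by (simp add: N_def cinv_y0)
  have "smooth_on W N" using smooth chart_at(1) unfolding smooth_fun_def N_def by blast
  then have N: "(N has_derivative dN) (at y0)"
    unfolding dN_def using W(2) differentiable_if_smooth_on frechet_derivative_works by blast
  have dN: "dN u = spin_conn M a \<psi> x u - (1/4) *\<^sub>R B"
    by (simp add: spin_conn_eq B_def dN_def N_def)
  have unit': "\<psi> q \<bullet> \<psi> q = 1" if "q \<in> patch M a" for q using unit[OF that] by (simp add: norm_eq_1)
  have R': "vol (\<psi> x) = - cl M r (\<psi> x)" using R[OF x] by (simp add: cmult_coords r_def)
  have r: "r $ i = - (vol (\<psi> x) \<bullet> cl M (axis i 1) (\<psi> x))" for i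
    by (simp add: R' cl_inner_cl unit'[OF x] inner_axis)

  \<comment> \<open>On the patch the coefficient of \<alpha> becomes a sum of products: metric
    coefficients with the frame times scalar functions of the spinor alone. Each factor can be
    differentiated.\<close>
  have local: "met M (cinv c y) (R (cinv c y)) (from_chart (atl M) c (cinv c y) w) =
      - (\<Sum>i\<in>UNIV. metric_in_chart (atl M) (met M) c y w (frame_in_chart i y) *
        (vol (N y) \<bullet> cl M (axis i 1) (N y)))" if y: "y \<in> W" for y
  proof -
    define q where "q = cinv c y"
    have q: "q \<in> patch M a" by (simp add: q_def cinv_W(1)[OF y])
    define v where "v = coords q (from_chart (atl M) c q w)"
    have "met M q (R q) (from_chart (atl M) c q w) = coords q (R q) \<bullet> v"
      by (simp add: met_coords[OF q] v_def)
    also have "\<dots> = - (vol (\<psi> q) \<bullet> cl M v (\<psi> q))"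
      by (simp add: R[OF q] cmult_coords cl_inner_cl unit'[OF q])
    also have "cl M v (\<psi> q) = (\<Sum>i\<in>UNIV. (v $ i) *\<^sub>R cl M (axis i 1) (\<psi> q))"
      by (rule cl_axis_sum)
    finally show ?thesis
      by (simp add: metric_frame[OF y] inner_sum_right N_def q_def v_def)
  qed
  have "((\<lambda>y. - (\<Sum>i\<in>UNIV. metric_in_chart (atl M) (met M) c y w (frame_in_chart i y) *
        (vol (N y) \<bullet> cl M (axis i 1) (N y)))) has_derivative
     (\<lambda>u. - (\<Sum>i\<in>UNIV. met M x w (e i) * (vol (\<psi> x) \<bullet> cl M (axis i 1) (dN u) + vol (dN u) \<bullet> cl M (axis i 1) (\<psi> x)) +
        (dm u w (e i) + met M x w (dframe i u)) * (vol (\<psi> x) \<bullet> cl M (axis i 1) (\<psi> x))))) (at y0)"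
  proof (intro has_derivative_minus has_derivative_sum)
    fix i :: 5
    have m: "((\<lambda>y. metric_in_chart (atl M) (met M) c y w (frame_in_chart i y)) has_derivative
        (\<lambda>u. dm u w (e i) + met M x w (dframe i u))) (at y0)"
      using has_derivative_product[OF has_derivative_const[of w] has_derivative_frame[of i]]
      by (simp add: metric_y0 frame_y0 met_simps)
    have v: "((\<lambda>y. vol (N y)) has_derivative (\<lambda>u. vol (dN u))) (at y0)"
      by (rule bounded_linear.has_derivative[OF linear_conv_bounded_linear[THEN iffD1, OF linear_vol] N])
    have cl: "((\<lambda>y. cl M (axis i 1) (N y)) has_derivative (\<lambda>u. cl M (axis i 1) (dN u))) (at y0)"
      by (rule bounded_linear.has_derivative[OF linear_conv_bounded_linear[THEN iffD1, OF linear_cl] N])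
    show "((\<lambda>y. metric_in_chart (atl M) (met M) c y w (frame_in_chart i y) *
        (vol (N y) \<bullet> cl M (axis i 1) (N y))) has_derivative
        (\<lambda>u. met M x w (e i) * (vol (\<psi> x) \<bullet> cl M (axis i 1) (dN u) + vol (dN u) \<bullet> cl M (axis i 1) (\<psi> x)) +
        (dm u w (e i) + met M x w (dframe i u)) * (vol (\<psi> x) \<bullet> cl M (axis i 1) (\<psi> x)))) (at y0)"
      using has_derivative_mult[OF m has_derivative_inner[OF v cl]]
      by (simp only: N0 metric_y0 frame_y0)
  qed
  then have "((\<lambda>y. met M (cinv c y) (R (cinv c y)) (from_chart (atl M) c (cinv c y) w)) has_derivative
     (\<lambda>u. - (\<Sum>i\<in>UNIV. met M x w (e i) * (vol (\<psi> x) \<bullet> cl M (axis i 1) (dN u) + vol (dN u) \<bullet> cl M (axis i 1) (\<psi> x)) +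
        (dm u w (e i) + met M x w (dframe i u)) * (vol (\<psi> x) \<bullet> cl M (axis i 1) (\<psi> x))))) (at y0)"
    by (rule has_derivative_transform_within_open[OF _ W]) (simp only: local)
  from frechet_derivative_at[OF this, symmetric]
  have "frechet_derivative (\<lambda>y. met M (cinv c y) (R (cinv c y)) (from_chart (atl M) c (cinv c y) w)) (at y0) u
    = - (\<Sum>i\<in>UNIV. (wx $ i) * (vol (\<psi> x) \<bullet> cl M (axis i 1) (dN u) + vol (dN u) \<bullet> cl M (axis i 1) (\<psi> x)) -
        (dm u w (e i) + met M x w (dframe i u)) * r $ i)"
    by (simp add: r wx_def coords_def)
  also have "\<dots> = (\<Sum>i\<in>UNIV. r $ i * (dm u w (e i) + met M x w (dframe i u)))
     - (vol (\<psi> x) \<bullet> cl M wx (dN u) + vol (dN u) \<bullet> cl M wx (\<psi> x))"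
    by (subst (1 2) cl_axis_sum[of wx])
      (simp add: sum_subtractf inner_sum_right distrib_left distrib_right sum.distrib mult.commute[of "r $ _"])
  \<comment> \<open>\<open>vol\<close> and \<open>wx\<close> are skew and commute, so both halves of
    the spinor derivative agree; hence the factor 2 in the result.\<close>
  also have "vol (\<psi> x) \<bullet> cl M wx (dN u) = vol (dN u) \<bullet> cl M wx (\<psi> x)"
    using cl_skew[of wx "vol (\<psi> x)" "dN u"] vol_skew[of "cl M wx (\<psi> x)" "dN u"]
    by (simp add: vol_cl inner_commute)
  \<comment> \<open>The coefficient 1/2 is -1/4 from the spin connection times -2 from
    \<open>vol_rotation_inner\<close>.\<close>
  also have "vol (dN u) \<bullet> cl M wx (\<psi> x) = vol (spin_conn M a \<psi> x u) \<bullet> cl M wx (\<psi> x)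
      + (1/2) * (\<Sum>i\<in>UNIV. \<Sum>j\<in>UNIV. \<Gamma> u i j * r $ i * wx $ j)"
    using vol_rotation_inner[where G = "\<Gamma> u" and w = wx, OF \<Gamma>_skew R' unit[OF x]]
    by (simp add: dN vol_simps inner_diff_left B_def)
  \<comment> \<open>Trading the frame derivative for \<open>\<Gamma>\<close> produces the same
    double sum, which cancels the previous one after doubling, and leaves first-kind Christoffel
    symbols.\<close>
  also have "(\<Sum>i\<in>UNIV. r $ i * (dm u w (e i) + met M x w (dframe i u))) =
     (\<Sum>i\<in>UNIV. r $ i * ((dm u w (e i) + dm w u (e i) - dm (e i) u w) / 2)) +
     (\<Sum>i\<in>UNIV. \<Sum>j\<in>UNIV. \<Gamma> u i j * r $ i * wx $ j)"
  proof -
    have "(\<Sum>j\<in>UNIV. \<Gamma> u i j * r $ i * wx $ j) = r $ i *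
        (met M x w (dframe i u) + (dm u w (e i) + dm (e i) u w - dm w u (e i)) / 2)" for i
    proof -
      have "(\<Sum>j\<in>UNIV. \<Gamma> u i j * wx $ j) =
          met M x (levi_civita (atl M) (met M) (\<lambda>y. frame M a y i) x u) w"
        unfolding \<Gamma>_def met_coords[OF x, of _ w] by (simp add: inner_vec_def coords_def wx_def)
      then show ?thesis
        by (simp add: met_levi_civita met_commute[of x w] dm_commute[of u w] sum_distrib_left[symmetric] mult_ac)
    qed
    then show ?thesis
      by (simp flip: sum.distrib) (auto intro!: sum.cong simp: field_simps)
  qed
  finally show ?thesis by (simp add: cmult_coords r_def wx_def)
qed

lemma ext_deriv_dual_form:
  assumes "smooth_fun (atl M) (patch M a) \<psi>"
    and "\<And>q. q \<in> patch M a \<Longrightarrow> norm (\<psi> q) = 1"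
    and "\<And>q. q \<in> patch M a \<Longrightarrow> vol (\<psi> q) = - cmult M a q (R q) (\<psi> q)"
  shows "ext_deriv (atl M) (\<lambda>q. met M q (R q)) x u v =
    2 * (vol (spin_conn M a \<psi> x v) \<bullet> cmult M a x u (\<psi> x))
    - 2 * (vol (spin_conn M a \<psi> x u) \<bullet> cmult M a x v (\<psi> x))"
proof -
  note D = frechet_derivative_dual_form[where \<psi> = \<psi> and R = R, OF assms]
  have "ext_deriv (atl M) (\<lambda>q. met M q (R q)) x u v =
    frechet_derivative (\<lambda>y. met M (cinv c y) (R (cinv c y)) (from_chart (atl M) c (cinv c y) v)) (at y0) u
    - frechet_derivative (\<lambda>y. met M (cinv c y) (R (cinv c y)) (from_chart (atl M) c (cinv c y) u)) (at y0) v"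
    by (simp add: ext_deriv_def Let_def)
  also have "\<dots> = 2 * (vol (spin_conn M a \<psi> x v) \<bullet> cmult M a x u (\<psi> x))
    - 2 * (vol (spin_conn M a \<psi> x u) \<bullet> cmult M a x v (\<psi> x))"
    \<comment> \<open>Vanishing torsion enters here as the symmetry of the Christoffel symbols in
      \<open>u\<close> and \<open>v\<close>.\<close>
    using D[of v u] D[of u v] dm_commute[of "e _" u v] by (simp add: add.commute)
  finally show ?thesis .
qed

end

section \<open>The structure defined by a unit spinor\<close>

lemma nat_1_3: "{1..3} = {1, 2, 3 :: nat}"
  by auto

context spin_manifold_patch begin

text \<open>Two candidates for the projection differ by a vector of \<open>E\<close> orthogonal to
  \<open>E\<close>, which is zero because the metric is positive definite.\<close>

lemma oproj_hyperplane:
  assumes E: "\<And>v. v \<in> E \<longleftrightarrow> met M q n v = 0" and n: "met M q n n = 1"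
  shows "oproj (met M q) E v = v - met M q n v *\<^sub>R n"
  unfolding oproj_def
proof (rule the_equality)
  show "v - met M q n v *\<^sub>R n \<in> E \<and> (\<forall>w\<in>E. met M q (v - (v - met M q n v *\<^sub>R n)) w = 0)"
    by (simp add: E n met_simps)
  fix u assume u: "u \<in> E \<and> (\<forall>w\<in>E. met M q (v - u) w = 0)"
  define z where "z = v - met M q n v *\<^sub>R n - u"
  have "z \<in> E" using u by (simp add: z_def E n met_simps)
  then have "met M q (v - u) z = 0" "met M q n z = 0" using u by (simp_all add: E)
  then have "met M q (v - met M q n v *\<^sub>R n - u) z = 0" by (simp add: met_simps)
  then have "met M q z z = 0" by (simp only: z_def)
  then have "z = 0"
    using riemannian unfolding riemannian_metric_def by (metis less_irrefl)
  then show "u = v - met M q n v *\<^sub>R n"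
    by (simp add: z_def)
qed

end

section \<open>The fibres of \<xi> and the direction of R\<close>

locale su2_structure = spin_manifold_patch +
  fixes j2 \<eta> \<xi> J R
  assumes parallel: "parallel_anticommuting_structure M j2"
    and unit: "unit_spinor M \<eta>"
    and su2: "su2_structure_of M j2 \<eta> \<xi> J R"
begin

lemma xi_subspace: "subspace (\<xi> q)" "dim (\<xi> q) = 4"
  and R_unit: "met M q (R q) (R q) = 1" and R_orth: "v \<in> \<xi> q \<Longrightarrow> met M q (R q) v = 0"
  using su2 unfolding su2_structure_of_def smooth_rank4_subbundle_def by blast+

lemma J_xi: "k \<in> {1..3} \<Longrightarrow> v \<in> \<xi> q \<Longrightarrow> J k q v \<in> \<xi> q"
  using su2 by (simp add: su2_structure_of_def section_End_def)

text \<open>Every vector of the model space consists of the frame components of some tangent vector,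
  so the relation for \<open>cmult\<close> transfers to \<open>cl\<close>.\<close>

lemma anticommuting_j2:
  assumes q: "q \<in> patch M a"
  shows "anticommuting_structure (j2 a q)"
proof -
  have j: "linear (j2 a q)" "norm (j2 a q w) = norm w" "j2 a q (j2 a q w) = - w"
    "j2 a q (cmult M a q v w) = - cmult M a q v (j2 a q w)" for v w
    using parallel q by (simp_all add: parallel_anticommuting_structure_def)
  have "j2 a q (cl M v w) = - cl M v (j2 a q w)" for v w
    using j(4)[of "\<Sum>i\<in>UNIV. (v $ i) *\<^sub>R frame M a q i" w]
    by (simp add: cmult_coords coords_sum_frame[OF q])
  with j(1-3) show ?thesis by (simp add: anticommuting_structure_def)
qed

lemma norm_spinor: "q \<in> patch M a \<Longrightarrow> norm (\<eta> a q) = 1"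
  using unit unfolding unit_spinor_def by blast

lemma jspin_eq:
  assumes "q \<in> patch M a"
  shows "jspin M j2 1 a q w = vol w" "jspin M j2 2 a q w = j2 a q w" "jspin M j2 3 a q w = vol (j2 a q w)"
  by (simp_all add: jspin_def vol_mult_eq[OF assms])

lemma cmult_J:
  assumes "q \<in> patch M a" "v \<in> \<xi> q"
  shows "cmult M a q (J 1 q v) (\<eta> a q) = vol (cmult M a q v (\<eta> a q))"
    "cmult M a q (J 2 q v) (\<eta> a q) = j2 a q (cmult M a q v (\<eta> a q))"
    "cmult M a q (J 3 q v) (\<eta> a q) = vol (j2 a q (cmult M a q v (\<eta> a q)))"
proof -
  have "cmult M a q (J k q v) (\<eta> a q) = jspin M j2 k a q (cmult M a q v (\<eta> a q))" if "k \<in> {1..3}" for k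
    using su2 assms that by (simp add: su2_structure_of_def)
  from this[of 1] this[of 2] this[of 3] show
    "cmult M a q (J 1 q v) (\<eta> a q) = vol (cmult M a q v (\<eta> a q))"
    "cmult M a q (J 2 q v) (\<eta> a q) = j2 a q (cmult M a q v (\<eta> a q))"
    "cmult M a q (J 3 q v) (\<eta> a q) = vol (j2 a q (cmult M a q v (\<eta> a q)))"
    by (simp_all add: jspin_eq[OF assms(1)] del: One_nat_def)
qed

lemma met_cmult: "q \<in> patch M a \<Longrightarrow> met M q u v = cmult M a q u (\<eta> a q) \<bullet> cmult M a q v (\<eta> a q)"
  by (simp add: met_coords cmult_coords cl_inner_cl power2_norm_eq_inner[symmetric] norm_spinor)

text \<open>One inclusion is orthogonality to \<open>R\<close>; equality follows because both
  subspaces have dimension 4.\<close>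

lemma coords_xi:
  assumes q: "q \<in> patch M a"
  shows "coords q ` \<xi> q = {w. coords q (R q) \<bullet> w = 0}"
proof (rule subspace_dim_equal)
  show "subspace (coords q ` \<xi> q)" by (rule linear_subspace_image[OF linear_coords xi_subspace(1)])
  show "subspace {w. coords q (R q) \<bullet> w = 0}" by (rule subspace_hyperplane)
  show "coords q ` \<xi> q \<subseteq> {w. coords q (R q) \<bullet> w = 0}"
    using R_orth by (auto simp flip: met_coords[OF q])
  have "inj (coords q)" by (simp add: inj_def coords_inject[OF q])
  then have "dim (coords q ` \<xi> q) = 4"
    using dim_image_eq[OF linear_coords] xi_subspace(2) by (metis inj_on_subset subset_UNIV)
  moreover have "coords q (R q) \<noteq> 0" using R_unit[of q] by (auto simp: met_coords[OF q])
  ultimately show "dim {w. coords q (R q) \<bullet> w = 0} \<le> dim (coords q ` \<xi> q)"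
    by (simp add: dim_hyperplane)
qed

lemma xi_iff:
  assumes q: "q \<in> patch M a"
  shows "v \<in> \<xi> q \<longleftrightarrow> met M q (R q) v = 0"
proof
  assume "met M q (R q) v = 0"
  then have "coords q v \<in> coords q ` \<xi> q" by (simp add: coords_xi[OF q] met_coords[OF q])
  then show "v \<in> \<xi> q" by (auto simp: coords_inject[OF q])
qed (rule R_orth)

lemma oproj_xi: "q \<in> patch M a \<Longrightarrow> oproj (met M q) (\<xi> q) v = v - met M q (R q) v *\<^sub>R R q"
  by (rule oproj_hyperplane[OF xi_iff R_unit])

lemma oproj_mem: "q \<in> patch M a \<Longrightarrow> oproj (met M q) (\<xi> q) v \<in> \<xi> q"
  by (simp add: oproj_xi xi_iff met_simps R_unit)

lemma oproj_id: "q \<in> patch M a \<Longrightarrow> v \<in> \<xi> q \<Longrightarrow> oproj (met M q) (\<xi> q) v = v"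
  by (simp add: oproj_xi R_orth)

lemma met_oproj: "q \<in> patch M a \<Longrightarrow> u \<in> \<xi> q \<Longrightarrow> met M q u (oproj (met M q) (\<xi> q) v) = met M q u v"
  using met_commute[of q u "R q"] by (simp add: oproj_xi met_simps R_orth)

lemma vol_spinor:
  assumes q: "q \<in> patch M a"
  shows "vol (\<eta> a q) = - cmult M a q (R q) (\<eta> a q)"
proof -
  define r where "r = coords q (R q)"
  define \<epsilon> where "\<epsilon> = cl M r (\<eta> a q) \<bullet> vol (\<eta> a q)"
  have r: "r \<bullet> r = 1" using R_unit[of q] by (simp add: r_def met_coords[OF q])
  have \<epsilon>: "cl M r (\<eta> a q) = \<epsilon> *\<^sub>R vol (\<eta> a q)"
    unfolding \<epsilon>_def
  proof (rule vol_parallel_of_orthogonal[OF anticommuting_j2[OF q], where E = "coords q ` \<xi> q"])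
    have "(\<lambda>v. cmult M a q v (\<eta> a q)) ` \<xi> q =
        (span ({\<eta> a q} \<union> (\<lambda>k. jspin M j2 k a q (\<eta> a q)) ` {1..3}))\<^sup>\<bottom>"
      using su2 q unfolding su2_structure_of_def by blast
    then show "(\<lambda>v. cl M v (\<eta> a q)) ` coords q ` \<xi> q =
        (span {\<eta> a q, vol (\<eta> a q), j2 a q (\<eta> a q), vol (j2 a q (\<eta> a q))})\<^sup>\<bottom>"
      by (simp add: nat_1_3 jspin_eq[OF q] image_image cmult_coords insert_commute del: One_nat_def)
    show "r \<bullet> v = 0" if "v \<in> coords q ` \<xi> q" for v
      using that by (simp add: coords_xi[OF q] r_def)
  qed (rule norm_spinor[OF q])
  \<comment> \<open>Together with \<open>r\<close>, at most three vectors cannot span five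
    dimensions; orthogonality to \<open>r\<close> puts the new vector into \<xi>.\<close>
  have unit_orth: "\<exists>v. v \<in> \<xi> q \<and> coords q v \<bullet> coords q v = 1 \<and> (\<forall>w\<in>B. coords q v \<bullet> w = 0)"
    if B: "card B \<le> 3" "finite B" for B
  proof -
    have "dim (insert r B) \<le> card (insert r B)" using B(2) by (intro dim_le_card') simp
    also have "\<dots> < DIM(real^5)" using B by (simp add: card_insert_if)
    finally obtain y where y: "y \<noteq> 0" "\<And>w. w \<in> span (insert r B) \<Longrightarrow> orthogonal y w"
      using orthogonal_to_subspace_exists by blast
    define z where "z = y /\<^sub>R norm y"
    have z: "z \<bullet> w = 0" if "w \<in> insert r B" for w
      using y(2)[OF span_base[OF that]] by (simp add: z_def orthogonal_def)
    have "z \<in> coords q ` \<xi> q"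
      using z[of r] by (simp add: coords_xi[OF q] r_def inner_commute)
    moreover have "z \<bullet> z = 1" using y(1) by (simp add: z_def power2_norm_eq_inner[symmetric] power2_eq_square)
    ultimately show ?thesis using z by blast
  qed
  obtain X where X: "X \<in> \<xi> q" "coords q X \<bullet> coords q X = 1"
    using unit_orth[of "{}"] by auto
  have "card {coords q X, coords q (J 1 q X)} \<le> 3" by (simp add: card_insert_if)
  from unit_orth[OF this] obtain Y where Y: "Y \<in> \<xi> q" "coords q Y \<bullet> coords q Y = 1"
    "coords q Y \<bullet> coords q X = 0" "coords q Y \<bullet> coords q (J 1 q X) = 0"
    by auto
  have orth: "coords q v \<bullet> r = 0" if "v \<in> \<xi> q" for v
    using R_orth[OF that] by (simp add: r_def met_coords[OF q] inner_commute)
  have JX: "J 1 q X \<in> \<xi> q" and JY: "J 1 q Y \<in> \<xi> q" using J_xi[of 1] X(1) Y(1) by auto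
  define b :: "5 \<Rightarrow> real^5" where
    "b i = (if i = 1 then X else if i = 2 then J 1 q X else if i = 3 then Y else if i = 4 then J 1 q Y else R q)" for i
  have b: "b 1 = X" "b 2 = J 1 q X" "b 3 = Y" "b 4 = J 1 q Y" "b 5 = R q"
    by (simp_all add: b_def)
  have JJ: "met M q (J 1 q u) (J 1 q v) = met M q u v" if "u \<in> \<xi> q" "v \<in> \<xi> q" for u v
    using that by (simp add: met_cmult[OF q] cmult_J[OF q] vol_inner_vol del: One_nat_def)
  have "omega M \<xi> J 1 q u v = met M q (J 1 q u) v" if "u \<in> \<xi> q" "v \<in> \<xi> q" for u v
    using that by (simp add: omega_def oproj_id[OF q])
  \<comment> \<open>Only the product of the values on (X, J1 X) and (Y, J1 Y), both 1, survives; the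
    choice of Y kills the mixed terms.\<close>
  then have "wedge_square (omega M \<xi> J 1 q) (b 1) (b 2) (b 3) (b 4) = 2"
    using X Y by (simp add: b wedge_square_def JX JY JJ met_coords[OF q, of X] met_coords[OF q, of Y]
        met_coords[OF q, of "J 1 q X" Y] inner_commute del: One_nat_def)
  moreover have "b i \<in> \<xi> q" if "i \<noteq> 5" for i
    using exhaust_5[of i] that X(1) Y(1) JX JY b by metis
  moreover have "(\<forall>i. i \<noteq> 5 \<longrightarrow> b i \<in> \<xi> q) \<and> b 5 = R q \<and>
        wedge_square (omega M \<xi> J 1 q) (b 1) (b 2) (b 3) (b 4) > 0 \<longrightarrow> positive_basis b"
    using su2 unfolding su2_structure_of_def by blast
  ultimately have "positive_basis b" using b(5) by auto
  then have "det (\<chi> i. coords q (b i)) > 0" by (rule det_coords[OF q])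
  then have "\<epsilon> = - 1"
    using vol_sign_of_oriented_basis[OF norm_spinor[OF q] r \<epsilon> X(2) orth[OF X(1)] _ Y(2) orth[OF Y(1)] Y(3,4),
        of "coords q (J 1 q Y)" "\<chi> i. coords q (b i)"] cmult_J(1)[OF q X(1)] cmult_J(1)[OF q Y(1)]
    by (simp add: b r_def cmult_coords del: One_nat_def)
  then show ?thesis using \<epsilon> by (simp add: cmult_coords r_def)
qed

end

section \<open>Contributions of the components of \<nabla>\<eta>\<close>

context su2_structure begin

text \<open>Multiplication into \<eta> carries these to relations between the skew, anticommuting
  operators \<open>vol\<close> and \<open>j2\<close> on spinors.\<close>

lemma met_J:
  assumes q: "q \<in> patch M a" and u: "u \<in> \<xi> q" and v: "v \<in> \<xi> q"
  shows met_J1_skew: "met M q (J 1 q u) v = - met M q u (J 1 q v)"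
    and met_J2_J1: "met M q (J 2 q u) (J 1 q v) = - met M q (J 3 q u) v"
    and met_J3_J1: "met M q (J 3 q u) (J 1 q v) = met M q (J 2 q u) v"
    and met_J1_J1: "met M q (J 1 q u) (J 1 q v) = met M q u v"
    and met_J2_skew: "met M q (J 2 q u) v = - met M q u (J 2 q v)"
    and met_J3_skew: "met M q (J 3 q u) v = - met M q u (J 3 q v)"
proof -
  note j = anticommuting_j2[OF q]
  show "met M q (J 1 q u) v = - met M q u (J 1 q v)"
    by (simp add: met_cmult[OF q] cmult_J[OF q] u v vol_skew del: One_nat_def)
  show "met M q (J 2 q u) (J 1 q v) = - met M q (J 3 q u) v"
    by (simp add: met_cmult[OF q] cmult_J[OF q] u v vol_skew del: One_nat_def)
  show "met M q (J 3 q u) (J 1 q v) = met M q (J 2 q u) v"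
    by (simp add: met_cmult[OF q] cmult_J[OF q] u v vol_inner_vol del: One_nat_def)
  show "met M q (J 1 q u) (J 1 q v) = met M q u v"
    by (simp add: met_cmult[OF q] cmult_J[OF q] u v vol_inner_vol del: One_nat_def)
  show "met M q (J 2 q u) v = - met M q u (J 2 q v)"
    by (simp add: met_cmult[OF q] cmult_J[OF q] u v anticommuting_skew[OF j])
  show "met M q (J 3 q u) v = - met M q u (J 3 q v)"
    by (simp add: met_cmult[OF q] cmult_J[OF q] u v vol_skew anticommuting_skew[OF j] anticommuting_vol[OF j])
qed

text \<open>\<open>vol\<close> sends the three \<jmath> terms to multiples of \<eta>,
  \<open>vol (j2 \<eta>)\<close> and \<open>j2 \<eta>\<close>, all orthogonal to every vector times
  \<eta>. On the rest \<open>vol\<close> acts as \<open>J 1\<close>, which stays in \<xi> and sees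
  only the projection of \<open>Y\<close>.\<close>

lemma vol_spin_conn_inner:
  assumes q: "q \<in> patch M a" and D: "spinor_decomposition M j2 \<eta> \<xi> R S V \<Theta> \<phi>"
  shows "vol (spin_conn M a (\<eta> a) q X) \<bullet> cmult M a q Y (\<eta> a q) =
    - met M q (S q (oproj (met M q) (\<xi> q) X)) (J 1 q (oproj (met M q) (\<xi> q) Y))
    - met M q (R q) X * met M q (V q) (J 1 q (oproj (met M q) (\<xi> q) Y))"
proof -
  note j = anticommuting_j2[OF q]
  define X' where "X' = oproj (met M q) (\<xi> q) X"
  define Y' where "Y' = oproj (met M q) (\<xi> q) Y"
  have mem: "X' \<in> \<xi> q" "Y' \<in> \<xi> q" by (simp_all add: X'_def Y'_def oproj_mem[OF q])
  have S: "S q X' \<in> \<xi> q" and V: "V q \<in> \<xi> q"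
    using D mem by (simp_all add: spinor_decomposition_def section_End_def)
  have J: "vol (cmult M a q u (\<eta> a q)) \<bullet> cmult M a q Y (\<eta> a q) = - met M q u (J 1 q Y')" if u: "u \<in> \<xi> q" for u
  proof -
    have "vol (cmult M a q u (\<eta> a q)) \<bullet> cmult M a q Y (\<eta> a q) = met M q (J 1 q u) Y"
      by (simp add: met_cmult[OF q] cmult_J[OF q u] del: One_nat_def)
    also have "\<dots> = met M q (J 1 q u) Y'"
      unfolding Y'_def by (rule met_oproj[OF q, symmetric]) (use J_xi[of 1] u in auto)
    finally show ?thesis by (simp only: met_J1_skew[OF q u mem(2)])
  qed
  define t where "t l = \<Theta> l q X' + met M q (R q) X * \<phi> l q" for l
  have "spin_conn M a (\<eta> a) q X =
          cmult M a q (S q X') (\<eta> a q) + met M q (R q) X *\<^sub>R cmult M a q (V q) (\<eta> a q) +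
          (\<Sum>l\<in>{1..3}. t l *\<^sub>R jspin M j2 l a q (\<eta> a q))"
    using D q by (simp add: spinor_decomposition_def Let_def X'_def t_def)
  moreover have "vol (\<Sum>l\<in>{1..3}. t l *\<^sub>R jspin M j2 l a q (\<eta> a q)) \<bullet> cmult M a q Y (\<eta> a q) = 0"
    by (simp add: nat_1_3 jspin_eq[OF q] vol_simps vol_vol cmult_coords inner_add_right inner_diff_right
        inner_commute[of _ "cl M (coords q Y) (\<eta> a q)"] cl_inner_same
        cl_inner_anticommuting[OF j] cl_inner_vol_anticommuting[OF j] del: One_nat_def)
  ultimately show ?thesis
    by (simp add: vol_simps inner_add_left J[OF S] J[OF V] del: One_nat_def flip: X'_def Y'_def)
qed

text \<open>A component T with transpose T* contributes - g((J1 T + T* J1) u, v). This vanishes for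
  T skew and commuting with J1 (J1 itself, S0) or symmetric and anticommuting (S2, S3). In the other
  cases it is -2 g(J1 T u, v), where J1 J2 = J3 and J1 J3 = - J2 explain the exchange of the indices
  2 and 3.\<close>

lemma endomorphism_decomposition_inner:
  assumes q: "q \<in> patch M a" and D: "endomorphism_decomposition M \<xi> J S \<mu> Sk lam S0"
    and u: "u \<in> \<xi> q" and v: "v \<in> \<xi> q"
  shows "met M q (S q u) (J 1 q v) - met M q (S q v) (J 1 q u) =
    - 2 * \<mu> q * met M q (J 1 q u) v + 2 * lam 3 q * met M q (J 2 q u) v - 2 * lam 2 q * met M q (J 3 q u) v
    - 2 * met M q (J 1 q (Sk 1 q u)) v"
proof -
  have S: "S q w = \<mu> q *\<^sub>R w + (Sk 1 q w + Sk 2 q w + Sk 3 q w) +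
      (lam 1 q *\<^sub>R J 1 q w + lam 2 q *\<^sub>R J 2 q w + lam 3 q *\<^sub>R J 3 q w) + S0 q w" if "w \<in> \<xi> q" for w
    using D that by (simp add: endomorphism_decomposition_def nat_1_3 add.assoc del: One_nat_def)
  have Sk: "\<forall>k\<in>{1..3}. (\<forall>u\<in>\<xi> q. Sk k q u \<in> \<xi> q) \<and>
      (\<forall>u\<in>\<xi> q. \<forall>v\<in>\<xi> q. met M q (Sk k q u) v = met M q u (Sk k q v)) \<and>
      (\<forall>u\<in>\<xi> q. Sk k q (J k q u) = J k q (Sk k q u)) \<and>
      (\<forall>l\<in>{1..3} - {k}. \<forall>u\<in>\<xi> q. Sk k q (J l q u) = - J l q (Sk k q u))"
    using D by (simp add: endomorphism_decomposition_def section_End_def)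
  have S0: "S0 q w \<in> \<xi> q" "met M q (S0 q w) z = - met M q w (S0 q z)" "S0 q (J 1 q w) = J 1 q (S0 q w)"
    if "w \<in> \<xi> q" "z \<in> \<xi> q" for w z
    using D that by (simp_all add: endomorphism_decomposition_def section_End_def)
  have J: "J 1 q u \<in> \<xi> q" "J 1 q v \<in> \<xi> q" using J_xi[of 1] u v by auto
  have skew: "met M q (J 1 q w) z = - met M q w (J 1 q z)" if "w \<in> \<xi> q" "z \<in> \<xi> q" for w z
    by (rule met_J1_skew[OF q that])
  have S_other: "met M q (Sk k q u) (J 1 q v) = met M q (Sk k q v) (J 1 q u)" if k: "k = 2 \<or> k = 3" for k
  proof -
    have k': "k \<in> {1..3}" "1 \<in> {1..3} - {k}" using k by auto
    have "met M q (Sk k q v) (J 1 q u) = met M q v (Sk k q (J 1 q u))"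
      using Sk k'(1) v J(1) by blast
    also have "Sk k q (J 1 q u) = - J 1 q (Sk k q u)" using Sk k' u by blast
    finally have "met M q (Sk k q v) (J 1 q u) = - met M q (J 1 q (Sk k q u)) v"
      by (simp add: met_simps met_commute)
    moreover have "Sk k q u \<in> \<xi> q" using Sk k'(1) u by blast
    ultimately show ?thesis using skew v by simp
  qed
  have S_one: "met M q (Sk 1 q u) (J 1 q v) = - met M q (J 1 q (Sk 1 q u)) v"
    "met M q (Sk 1 q v) (J 1 q u) = met M q (J 1 q (Sk 1 q u)) v"
  proof -
    have k: "1 \<in> {1..3::nat}" by auto
    have "Sk 1 q u \<in> \<xi> q" using Sk k u by blast
    then show "met M q (Sk 1 q u) (J 1 q v) = - met M q (J 1 q (Sk 1 q u)) v" using skew v by simp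
    have "met M q (Sk 1 q v) (J 1 q u) = met M q v (Sk 1 q (J 1 q u))"
      using Sk k v J(1) by blast
    also have "Sk 1 q (J 1 q u) = J 1 q (Sk 1 q u)" using Sk k u by blast
    finally show "met M q (Sk 1 q v) (J 1 q u) = met M q (J 1 q (Sk 1 q u)) v"
      by (simp add: met_commute)
  qed
  have S_zero: "met M q (S0 q u) (J 1 q v) = met M q (S0 q v) (J 1 q u)"
    using S0(2)[OF v J(1)] S0(3)[OF u u] skew[OF S0(1)[OF u u] v]
    by (simp add: met_commute[of q v])
  note J_rules = met_J2_J1[OF q u v] met_J2_J1[OF q v u] met_J3_J1[OF q u v] met_J3_J1[OF q v u]
    met_J1_J1[OF q u v] met_J1_J1[OF q v u]
  have "met M q v (J 1 q u) = met M q (J 1 q u) v" "met M q u (J 1 q v) = - met M q (J 1 q u) v"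
    "met M q (J 2 q v) u = - met M q (J 2 q u) v" "met M q (J 3 q v) u = - met M q (J 3 q u) v"
    using skew[OF u v] met_J2_skew[OF q v u] met_J3_skew[OF q v u]
    by (simp_all add: met_commute[of q v])
  then show ?thesis
    unfolding S[OF u] S[OF v]
    by (simp add: met_simps J_rules S_one S_zero S_other met_commute[of q v u] algebra_simps del: One_nat_def)
qed

end

theorem proposition4p17:
  fixes M :: "('m::{t2_space,second_countable_topology}, 'i, 'w::euclidean_space) spin_data"
    and j2 :: "'i \<Rightarrow> 'm \<Rightarrow> 'w \<Rightarrow> 'w" and \<eta> :: "'i \<Rightarrow> 'm \<Rightarrow> 'w"
    and \<xi> :: "'m \<Rightarrow> (real^5) set" and J :: "nat \<Rightarrow> 'm \<Rightarrow> real^5 \<Rightarrow> real^5" and R :: "'m \<Rightarrow> real^5"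
    and S S0 :: "'m \<Rightarrow> real^5 \<Rightarrow> real^5" and Sk :: "nat \<Rightarrow> 'm \<Rightarrow> real^5 \<Rightarrow> real^5"
    and V :: "'m \<Rightarrow> real^5" and \<Theta> :: "nat \<Rightarrow> 'm \<Rightarrow> real^5 \<Rightarrow> real"
    and \<phi> lam :: "nat \<Rightarrow> 'm \<Rightarrow> real" and \<mu> :: "'m \<Rightarrow> real"
    and \<alpha> \<tau>14 :: "'m \<Rightarrow> real^5 \<Rightarrow> real" and \<tau>0 :: "nat \<Rightarrow> 'm \<Rightarrow> real"
    and \<tau>24 :: "'m \<Rightarrow> real^5 \<Rightarrow> real^5 \<Rightarrow> real"
  assumes "spin_manifold M" and "DIM('w) = 8"
    and "parallel_anticommuting_structure M j2"
    and "smooth_spinor M \<eta>" and "unit_spinor M \<eta>"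
    and "su2_structure_of M j2 \<eta> \<xi> J R"
    and "spinor_decomposition M j2 \<eta> \<xi> R S V \<Theta> \<phi>"
    and "endomorphism_decomposition M \<xi> J S \<mu> Sk lam S0"
    and \<alpha>: "\<And>x X. \<alpha> x X = met M x (R x) X"
    and \<tau>0: "\<And>x. \<tau>0 1 x = - 4 * \<mu> x" "\<And>x. \<tau>0 2 x = 4 * lam 3 x" "\<And>x. \<tau>0 3 x = - 4 * lam 2 x"
    and \<tau>14: "\<And>x X. \<tau>14 x X = 2 * met M x (V x) (J 1 x (oproj (met M x) (\<xi> x) X))"
    and \<tau>24: "\<And>x X Y. \<tau>24 x X Y = - 4 * omega M \<xi> J 1 x (Sk 1 x (oproj (met M x) (\<xi> x) X)) Y"
  shows "ext_deriv (atl M) \<alpha> x X Y =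
           wedge1 (\<alpha> x) (\<tau>14 x) X Y + (\<Sum>k\<in>{1..3}. \<tau>0 k x * omega M \<xi> J k x X Y) + \<tau>24 x X Y"
proof -
  have "(\<Union>a. patch M a) = UNIV" using \<open>spin_manifold M\<close> by (simp add: spin_manifold_def)
  then obtain a where x: "x \<in> patch M a" by blast
  interpret spin_manifold_point M a x
    using \<open>spin_manifold M\<close> x by unfold_locales
  interpret su2_structure M a j2 \<eta> \<xi> J R
    using assms by unfold_locales
  let ?P = "oproj (met M x) (\<xi> x)"
  have P: "?P X \<in> \<xi> x" "?P Y \<in> \<xi> x" by (simp_all add: oproj_mem[OF x])
  have "Sk 1 x (?P X) \<in> \<xi> x"
    using assms(8) P(1) by (simp add: endomorphism_decomposition_def section_End_def)
  \<comment> \<open>\<open>omega\<close> projects its first argument again, harmlessly, since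
    \<open>Sk 1\<close> preserves \<xi>.\<close>
  then have \<tau>24': "\<tau>24 x X Y = - 4 * met M x (J 1 x (Sk 1 x (?P X))) (?P Y)"
    by (simp add: \<tau>24 omega_def oproj_id[OF x])
  have smooth: "smooth_fun (atl M) (patch M a) (\<eta> a)"
    using \<open>smooth_spinor M \<eta>\<close> by (simp add: smooth_spinor_def)
  have "\<alpha> = (\<lambda>q. met M q (R q))" by (simp add: fun_eq_iff \<alpha>)
  then have "ext_deriv (atl M) \<alpha> x X Y =
      2 * (vol (spin_conn M a (\<eta> a) x Y) \<bullet> cmult M a x X (\<eta> a x))
      - 2 * (vol (spin_conn M a (\<eta> a) x X) \<bullet> cmult M a x Y (\<eta> a x))"
    using ext_deriv_dual_form[OF smooth norm_spinor vol_spinor] by simp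
  \<comment> \<open>The two \<open>V\<close> terms are antisymmetrised products with \<alpha> and
    form the wedge term.\<close>
  also have "\<dots> = 2 * (met M x (S x (?P X)) (J 1 x (?P Y)) - met M x (S x (?P Y)) (J 1 x (?P X)))
      + wedge1 (\<alpha> x) (\<tau>14 x) X Y"
    unfolding vol_spin_conn_inner[OF x assms(7)] by (simp add: wedge1_def \<alpha> \<tau>14 algebra_simps)
  finally show ?thesis
    \<comment> \<open>The outer factor 2 doubles the coefficients of the decomposition into the
      stated multiples of 4.\<close>
    unfolding endomorphism_decomposition_inner[OF x assms(8) P]
    by (simp add: nat_1_3 omega_def \<tau>0 \<tau>24' algebra_simps del: One_nat_def)
qed

end
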